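(* Let $P=\sum_{i=1}^k\omega_iP_i$ be a mixture distribution on $\mathbb{R}^d$ with weights $\omega_i\ge0$, $\sum_i\omega_i=1$, sorted so that $\omega_1\ge\omega_2\ge\cdots\ge\omega_k$. Suppose each component $P_i$ has mean $\boldsymbol{\mu}_i$ and bounded total variance $\mathbb{E}_{\mathbf{X}\sim P_i}\bigl[\|\mathbf{X}-\boldsymbol{\mu}_i\|_2^2\bigr]\le\sigma_i^2$. Let $C_{\mathbf{X}}$ be the kernel covariance operator of $P$ with respect to the Gaussian kernel of bandwidth $\sigma>0$, and let $\lambda_1\ge\cdots\ge\lambda_k$ be its $k$ largest eigenvalues. Then $$\sum_{i=1}^k(\lambda_i-\omega_i)^2\;\le\;4\sum_{i=1}^k\omega_i\frac{\sigma_i^2}{\sigma^2}+16\sum_{i=2}^k\sum_{j=1}^{i-1}\omega_i\exp\Bigl(\frac{-\|\boldsymbol{\mu}_i-\boldsymbol{\mu}_j\|_2^2}{\sigma^2}\Bigr).$$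
   Context: The Gaussian kernel with bandwidth $\sigma$ is $k_{G(\sigma)}(\mathbf{x},\mathbf{y})=\exp\bigl(-\|\mathbf{x}-\mathbf{y}\|_2^2/(2\sigma^2)\bigr)$; let $\phi$ be a feature map into a Hilbert space $\mathcal{H}$ with $k(\mathbf{x},\mathbf{y})=\langle\phi(\mathbf{x}),\phi(\mathbf{y})\rangle$ (e.g. the reproducing kernel Hilbert space). For a distribution $P$ of a random vector $\mathbf{X}$, the kernel covariance operator is $C_{\mathbf{X}}=\mathbb{E}_{\mathbf{X}\sim P}\bigl[\phi(\mathbf{X})\phi(\mathbf{X})^\top\bigr]$, i.e. the positive semi-definite trace-class operator $h\mapsto\mathbb{E}[\langle\phi(\mathbf{X}),h\rangle\phi(\mathbf{X})]$ on $\mathcal{H}$; its eigenvalues are listed in non-increasing order with multiplicity (padded with zeros if needed). *)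

theory Defs
  imports "HOL-Analysis.Analysis" "HOL-Probability.Probability"
begin

definition gauss_kernel :: "real \<Rightarrow> 'a::real_normed_vector \<Rightarrow> 'a \<Rightarrow> real" where
  "gauss_kernel s x y = exp (- ((norm (x - y))\<^sup>2) / (2 * s\<^sup>2))"

text \<open>Kernel covariance operator of P w.r.t. feature map phi, in its defining (weak) form:
  C h = E[<phi X, h> phi X], i.e. <C h, g> = E[<phi X,h> <phi X,g>] for all h, g.\<close>
definition is_kernel_cov_op ::
  "'a measure \<Rightarrow> ('a \<Rightarrow> 'h::real_inner) \<Rightarrow> ('h \<Rightarrow> 'h) \<Rightarrow> bool" where
  "is_kernel_cov_op P phi C \<longleftrightarrow>
     (\<forall>h g. inner (C h) g = (\<integral>x. inner (phi x) h * inner (phi x) g \<partial>P))"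

definition op_eigenvalues :: "('h::real_vector \<Rightarrow> 'h) \<Rightarrow> real set" where
  "op_eigenvalues C = {\<mu>. \<exists>v. v \<noteq> 0 \<and> C v = \<mu> *\<^sub>R v}"

definition op_eigenspace :: "('h::real_vector \<Rightarrow> 'h) \<Rightarrow> real \<Rightarrow> 'h set" where
  "op_eigenspace C \<mu> = {v. C v = \<mu> *\<^sub>R v}"

definition eig_count :: "('h::real_vector \<Rightarrow> 'h) \<Rightarrow> real \<Rightarrow> nat" where
  "eig_count C t = (\<Sum>\<mu>\<in>{\<mu>\<in>op_eigenvalues C. t \<le> \<mu>}. dim (op_eigenspace C \<mu>))"

text \<open>i-th largest eigenvalue (i \<ge> 1), counted with multiplicity, padded with zeros:
  for a positive semi-definite operator only the positive eigenvalues are listed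
  in non-increasing order, the rest of the list is 0.\<close>
definition op_eigenvalue :: "('h::real_vector \<Rightarrow> 'h) \<Rightarrow> nat \<Rightarrow> real" where
  "op_eigenvalue C i =
     (if \<exists>t>0. i \<le> eig_count C t then Sup {t. 0 < t \<and> i \<le> eig_count C t} else 0)"

end

theory Submission
  imports Defs
begin

text \<open>Expanding the square, one needs an upper bound on \<open>\<Sum> \<lambda>\<^sub>i\<^sup>2\<close> and a lower bound on
  \<open>\<Sum> \<omega>\<^sub>i \<lambda>\<^sub>i\<close>. The sum of squares is at most the squared Hilbert-Schmidt norm
  \<open>E k(X, X')\<^sup>2\<close>. If \<open>m\<^sub>i\<close> is the mean embedding of \<open>P\<^sub>i\<close>, then
  \<open>\<Sum> \<omega>\<^sub>i m\<^sub>i m\<^sub>i\<^sup>T \<le> C\<close>, so by Ky Fan's principle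
  \<open>\<Sum>\<^sub>i\<^sub>\<le>\<^sub>r \<omega>\<^sub>i \<parallel>m\<^sub>i\<parallel>\<^sup>2 \<le> \<Sum>\<^sub>i\<^sub>\<le>\<^sub>r \<lambda>\<^sub>i\<close> for every \<open>r\<close>, and summation by parts
  against the sorted weights gives \<open>\<Sum> \<omega>\<^sub>i \<lambda>\<^sub>i \<ge> \<Sum> \<omega>\<^sub>i\<^sup>2 \<parallel>m\<^sub>i\<parallel>\<^sup>2\<close>. The resulting bound is
  \<open>\<Sum> \<omega>\<^sub>i \<omega>\<^sub>j E (k(X\<^sub>i, Y\<^sub>j) - \<delta>\<^sub>i\<^sub>j)\<^sup>2\<close> with independent \<open>X\<^sub>i\<close>, \<open>Y\<^sub>j\<close> drawn from \<open>P\<^sub>i\<close>, \<open>P\<^sub>j\<close> (a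
  Hoffman-Wielandt inequality for the integral operator on component-labelled points), and each
  term is estimated pointwise. The spectral theory of \<open>C\<close> is needed only above a level \<open>t > 0\<close>,
  where finitely many eigenvectors suffice; then \<open>t\<close> tends to \<open>0\<close>.\<close>

subsection \<open>Finite orthonormal families\<close>

text \<open>Finiteness is part of the notion because \<open>sum\<close> over an infinite set is 0;
  no infinite orthonormal system is ever summed.\<close>

definition orthonormal_family :: "'h::real_inner set \<Rightarrow> bool" where
  "orthonormal_family F \<longleftrightarrow> finite F \<and> (\<forall>u\<in>F. \<forall>v\<in>F. inner u v = (if u = v then 1 else 0))"

definition proj_on :: "'h::real_inner set \<Rightarrow> 'h \<Rightarrow> 'h" where
  "proj_on F h = (\<Sum>v\<in>F. inner h v *\<^sub>R v)"

lemma orthonormal_family_finite: "orthonormal_family F \<Longrightarrow> finite F"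
  by (simp add: orthonormal_family_def)

lemma orthonormal_family_norm:
  assumes "orthonormal_family F" "v \<in> F"
  shows "norm v = 1"
  using assms by (simp add: orthonormal_family_def norm_eq_sqrt_inner)

lemma orthonormal_family_subset:
  "orthonormal_family F \<Longrightarrow> G \<subseteq> F \<Longrightarrow> orthonormal_family G"
  by (auto simp: orthonormal_family_def finite_subset subset_iff)

lemma orthonormal_family_insert:
  assumes "orthonormal_family F" "norm u = 1" "\<forall>v\<in>F. inner u v = 0"
  shows "orthonormal_family (insert u F)" "u \<notin> F"
proof -
  have u: "inner u u = 1" using assms(2) by (simp add: norm_eq_sqrt_inner)
  show "u \<notin> F" using u assms(3) by fastforce
  show "orthonormal_family (insert u F)"
    using assms(1,3) u unfolding orthonormal_family_def by (auto simp: inner_commute)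
qed

lemma inner_sum_orthonormal:
  assumes "orthonormal_family F" "v \<in> F"
  shows "inner (\<Sum>u\<in>F. c u *\<^sub>R u) v = c v"
proof -
  have "inner (\<Sum>u\<in>F. c u *\<^sub>R u) v = (\<Sum>u\<in>F. c u * inner u v)"
    by (simp add: inner_sum_left)
  also have "\<dots> = (\<Sum>u\<in>F. if u = v then c u else 0)"
    using assms by (intro sum.cong) (auto simp: orthonormal_family_def)
  also have "\<dots> = c v" using assms by (simp add: orthonormal_family_def)
  finally show ?thesis .
qed

lemma inner_proj_on:
  "orthonormal_family F \<Longrightarrow> v \<in> F \<Longrightarrow> inner (proj_on F h) v = inner h v"
  unfolding proj_on_def by (rule inner_sum_orthonormal)

lemma inner_resid_proj:
  "orthonormal_family F \<Longrightarrow> v \<in> F \<Longrightarrow> inner (h - proj_on F h) v = 0"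
  by (simp add: inner_diff_left inner_proj_on)

lemma inner_proj_proj:
  assumes "orthonormal_family F"
  shows "inner (proj_on F h) g = (\<Sum>v\<in>F. inner h v * inner g v)"
  by (simp add: proj_on_def inner_sum_left inner_commute[of g])

lemma norm_proj_decomp:
  assumes "orthonormal_family F"
  shows "(norm h)\<^sup>2 = (\<Sum>v\<in>F. (inner h v)\<^sup>2) + (norm (h - proj_on F h))\<^sup>2"
proof -
  have "inner (h - proj_on F h) (proj_on F h) = 0"
    by (subst (2) proj_on_def) (simp add: inner_sum_right inner_resid_proj[OF assms])
  moreover have "inner h (proj_on F h) = (\<Sum>v\<in>F. (inner h v)\<^sup>2)"
    by (simp add: inner_commute[of h] inner_proj_proj[OF assms] power2_eq_square)
  ultimately show ?thesis
    by (simp add: power2_norm_eq_inner inner_diff_left inner_diff_right inner_commute)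
qed

lemma bessel_inequality:
  "orthonormal_family F \<Longrightarrow> (\<Sum>v\<in>F. (inner h v)\<^sup>2) \<le> (norm h)\<^sup>2"
  using norm_proj_decomp[of F h] by simp

lemma orthonormal_family_independent:
  assumes "orthonormal_family F"
  shows "independent F"
proof -
  have "\<forall>v\<in>F. u v = 0" if "(\<Sum>v\<in>F. u v *\<^sub>R v) = 0" for u
    using inner_sum_orthonormal[OF assms, of _ u] that by fastforce
  then show ?thesis
    using assms by (auto simp: dependent_finite orthonormal_family_def)
qed

text \<open>Gram-Schmidt. Spanning is phrased as being fixed by the projection; the cardinality
  bound is what later limits \<open>r\<close> mean embeddings to \<open>r\<close>
  eigenvalues.\<close>

lemma orthonormal_basis_exists:
  assumes "finite S"
  shows "\<exists>F. orthonormal_family F \<and> card F \<le> card S \<and> (\<forall>x\<in>S. proj_on F x = x)"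
  using assms
proof (induction S)
  case empty
  show ?case by (rule exI[of _ "{}"]) (simp add: orthonormal_family_def)
next
  case (insert x S)
  then obtain F where F: "orthonormal_family F" "card F \<le> card S" "\<forall>y\<in>S. proj_on F y = y"
    by blast
  show ?case
  proof (cases "x - proj_on F x = 0")
    case True
    then show ?thesis using F insert by (intro exI[of _ F]) auto
  next
    case False
    define u where "u = (x - proj_on F x) /\<^sub>R norm (x - proj_on F x)"
    have u: "norm u = 1" "\<forall>v\<in>F. inner u v = 0"
      using False F(1) by (auto simp: u_def inner_resid_proj)
    note G = orthonormal_family_insert[OF F(1) u]
    have sp: "proj_on (insert u F) y = inner y u *\<^sub>R u + proj_on F y" for y
      using G(2) F(1) by (simp add: proj_on_def orthonormal_family_def)
    have "inner y u = 0" if "y \<in> S" for y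
    proof -
      have "inner y u = inner (proj_on F y) u" using F(3) that by simp
      also have "\<dots> = 0" using u(2) by (simp add: inner_proj_proj[OF F(1)])
      finally show ?thesis .
    qed
    then have "\<forall>y\<in>S. proj_on (insert u F) y = y" using F(3) by (simp add: sp)
    moreover have "proj_on (insert u F) x = x"
    proof -
      have "inner x u = inner (x - proj_on F x) u"
        using u(2) by (simp add: inner_diff_left inner_proj_proj[OF F(1)])
      also have "\<dots> = norm (x - proj_on F x)"
        using False by (simp add: u_def power2_norm_eq_inner[symmetric] power2_eq_square)
      finally have "inner x u *\<^sub>R u = x - proj_on F x" using False by (simp add: u_def)
      then show ?thesis by (simp add: sp)
    qed
    ultimately show ?thesis using G F(1,2) insert
      by (intro exI[of _ "insert u F"]) (auto simp: orthonormal_family_def)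
  qed
qed

text \<open>Variational proof: the energy \<open>J\<close> is bounded below, the parallelogram law
  makes a minimizing sequence Cauchy, and minimality of its limit along every line says that the
  limit represents \<open>L\<close>.\<close>

lemma riesz_representation:
  fixes L :: "'h::{real_inner, complete_space} \<Rightarrow> real"
  assumes lin: "linear L" and bdd: "\<And>h. \<bar>L h\<bar> \<le> B * norm h"
  shows "\<exists>m. \<forall>h. L h = inner m h"
proof -
  interpret L: linear L by fact
  define J where "J h = (norm h)\<^sup>2 - 2 * L h" for h
  have low: "- B\<^sup>2 \<le> J h" for h
  proof -
    have "0 \<le> (norm h - B)\<^sup>2" by simp
    then show ?thesis using bdd[of h] by (simp add: J_def power2_diff abs_le_iff algebra_simps)
  qed
  define I where "I = Inf (range J)"
  have bb: "bdd_below (range J)" using low by (intro bdd_belowI2)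
  have I_le: "I \<le> J h" for h unfolding I_def using bb by (intro cInf_lower) auto
  \<comment> \<open>Parallelogram law: the linear parts of \<open>J\<close> cancel, so
    near-minimality of two points bounds their distance.\<close>
  have par: "(norm (h - g))\<^sup>2 = 2 * J h + 2 * J g - 4 * J ((1/2) *\<^sub>R (h + g))" for h g
    by (simp add: J_def L.scaleR L.add power2_norm_eq_inner inner_add_left inner_add_right
        inner_diff_left inner_diff_right inner_commute algebra_simps)
  have "\<exists>h. J h < I + 1 / Suc n" for n
  proof -
    have "Inf (range J) < I + 1 / Suc n" by (simp add: I_def)
    then show ?thesis by (subst (asm) cInf_less_iff) (use bb in auto)
  qed
  then obtain x where x: "\<And>n. J (x n) < I + 1 / Suc n" by metis
  have "Cauchy x"
  proof (rule metric_CauchyI)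
    fix e :: real assume "e > 0"
    then obtain N where N: "4 / e\<^sup>2 < real N" using reals_Archimedean2 by blast
    have "dist (x m) (x n) < e" if "m \<ge> N" "n \<ge> N" for m n
    proof -
      have q: "1 / real (Suc j) \<le> 1 / real (Suc N)" if "j \<ge> N" for j
        using that by (simp add: frac_le)
      have "(norm (x m - x n))\<^sup>2 < 4 / Suc N"
        using par[of "x m" "x n"] x[of m] x[of n] I_le[of "(1/2) *\<^sub>R (x m + x n)"]
          q[OF that(1)] q[OF that(2)] by simp
      also have "\<dots> \<le> e\<^sup>2" using N \<open>e > 0\<close> by (simp add: field_simps add_increasing)
      finally show ?thesis using \<open>e > 0\<close> by (simp add: dist_norm power2_less_imp_less)
    qed
    then show "\<exists>M. \<forall>m\<ge>M. \<forall>n\<ge>M. dist (x m) (x n) < e" by blast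
  qed
  then obtain z where z: "x \<longlonglongrightarrow> z" by (metis Cauchy_convergent convergent_def)
  have "bounded_linear L"
    by (rule bounded_linear_intro[of _ B]) (use bdd in \<open>auto simp: L.add L.scaleR mult.commute\<close>)
  then have "(\<lambda>n. J (x n)) \<longlonglongrightarrow> J z"
    unfolding J_def by (intro tendsto_intros z bounded_linear.tendsto[of L])
  moreover have "(\<lambda>n. I + 1 / real (Suc n)) \<longlonglongrightarrow> I + 0"
    by (intro tendsto_intros LIMSEQ_Suc[OF lim_1_over_n])
  ultimately have "J z \<le> I"
    using x by (intro LIMSEQ_le[of _ "J z" _ "I"]) (auto intro: less_imp_le)
  then have min: "J z \<le> J h" for h using I_le[of h] by simp
  have "L h = inner z h" for h
  proof (cases "h = 0")
    case True then show ?thesis by (simp add: L.zero)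
  next
    case False
    define c where "c = L h - inner z h"
    \<comment> \<open>This multiple of \<open>h\<close> is the best step from \<open>z\<close> along
      \<open>h\<close>; the gain \<open>c\<^sup>2 / (norm h)\<^sup>2\<close> has to vanish at a
      minimum.\<close>
    have "J z \<le> J (z + (c / (norm h)\<^sup>2) *\<^sub>R h)" by (rule min)
    also have "\<dots> = J z - c\<^sup>2 / (norm h)\<^sup>2"
    proof -
      have "J (z + t *\<^sub>R h) = J z - 2 * t * c + t * t * (norm h)\<^sup>2" for t
        by (simp add: J_def c_def L.scaleR L.add power2_norm_eq_inner inner_add_left inner_add_right
          inner_commute algebra_simps)
      from this[of "c / (norm h)\<^sup>2"] show ?thesis using False by (simp add: power2_eq_square)
    qed
    finally have "c\<^sup>2 / (norm h)\<^sup>2 \<le> 0" by simp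
    then have "c = 0" using False by (simp add: divide_le_0_iff)
    then show ?thesis by (simp add: c_def)
  qed
  then show ?thesis by blast
qed

section \<open>Decreasing enumerations and rearrangement of weights\<close>

lemma antitone_enumeration:
  fixes f :: "'a \<Rightarrow> real"
  assumes "finite F"
  shows "\<exists>e. bij_betw e {1..card F} F \<and>
    (\<forall>i j. 1 \<le> i \<longrightarrow> i \<le> j \<longrightarrow> j \<le> card F \<longrightarrow> f (e j) \<le> f (e i))"
  using assms
proof (induction "card F" arbitrary: F)
  case 0
  then show ?case by (auto simp: bij_betw_def)
next
  case (Suc n)
  then have "F \<noteq> {}" by auto
  then have "Min (f ` F) \<in> f ` F" using Suc by (intro Min_in) auto
  then obtain m where m: "m \<in> F" "f m = Min (f ` F)" by force
  have mle: "f m \<le> f x" if "x \<in> F" for x using m Suc that by (simp add: Min_le)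
  have n: "n = card (F - {m})" using Suc m by simp
  have "finite (F - {m})" using Suc by simp
  from Suc(1)[OF n this, folded n] obtain e where e: "bij_betw e {1..n} (F - {m})"
    "\<And>i j. 1 \<le> i \<Longrightarrow> i \<le> j \<Longrightarrow> j \<le> n \<Longrightarrow> f (e j) \<le> f (e i)"
    by blast
  \<comment> \<open>A minimizer of \<open>f\<close> is appended in last place, so the order of the
    rest is untouched.\<close>
  define e' where "e' = e(Suc n := m)"
  have "bij_betw e' {1..n} (F - {m})" using e(1) by (rule bij_betw_cong[THEN iffD1, rotated])
      (simp add: e'_def)
  moreover have "bij_betw e' {Suc n} {m}" by (simp add: e'_def)
  ultimately have "bij_betw e' ({1..n} \<union> {Suc n}) ((F - {m}) \<union> {m})"
    by (rule bij_betw_combine) auto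
  moreover have "{1..n} \<union> {Suc n} = {1..Suc n}" by auto
  moreover have "(F - {m}) \<union> {m} = F" using m by auto
  ultimately have b: "bij_betw e' {1..Suc n} F" by simp
  have "f (e' j) \<le> f (e' i)" if "1 \<le> i" "i \<le> j" "j \<le> Suc n" for i j
  proof (cases "j = Suc n")
    case True
    have "e' i \<in> F" using b that by (auto simp: bij_betw_def)
    then show ?thesis using True mle by (simp add: e'_def)
  next
    case False
    then show ?thesis using e(2)[of i j] that by (simp add: e'_def)
  qed
  then show ?case using b Suc(2) by auto
qed

text \<open>Bathtub principle: a total mass of at most \<open>r\<close>, with at most 1 per index,
  is best placed on the \<open>r\<close> largest values.\<close>

lemma weighted_sum_le_top_sum:
  fixes d c :: "nat \<Rightarrow> real"
  assumes d: "\<And>i j. 1 \<le> i \<Longrightarrow> i \<le> j \<Longrightarrow> j \<le> N \<Longrightarrow> d j \<le> d i"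
    and d0: "\<And>i. 1 \<le> i \<Longrightarrow> i \<le> N \<Longrightarrow> 0 \<le> d i"
    and c: "\<And>i. 0 \<le> c i" "\<And>i. c i \<le> 1" and csum: "(\<Sum>i=1..N. c i) \<le> real r"
  shows "(\<Sum>i=1..N. d i * c i) \<le> (\<Sum>i=1..min r N. d i)"
proof (cases "r < N")
  case False
  have "(\<Sum>i=1..N. d i * c i) \<le> (\<Sum>i=1..N. d i)"
    using c d0 by (intro sum_mono mult_left_le) auto
  then show ?thesis using False by simp
next
  case True
  \<comment> \<open>The value just beyond the cutoff acts as Lagrange multiplier for the mass
    constraint; since \<open>p\<close> is non-negative, the mass may be replaced by its bound
    \<open>r\<close>.\<close>
  define p where "p = d (Suc r)"
  have p0: "0 \<le> p" using True d0 by (simp add: p_def)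
  have le: "d i * c i \<le> (if i \<le> r then d i - p else 0) + p * c i" if "i \<in> {1..N}" for i
  proof (cases "i \<le> r")
    case True
    have "p \<le> d i" using d[of i "Suc r"] that True \<open>r < N\<close> by (simp add: p_def)
    then have "0 \<le> (d i - p) * (1 - c i)" using c[of i] by simp
    then show ?thesis using True by (simp add: algebra_simps)
  next
    case False
    then have "d i \<le> p" using d[of "Suc r" i] that by (simp add: p_def)
    then show ?thesis using False c(1)[of i] by (simp add: mult_right_mono)
  qed
  have int: "{1..N} \<inter> {..r} = {1..r}" using True by auto
  have "(\<Sum>i=1..N. if i \<le> r then d i - p else 0) = (\<Sum>i=1..N. if i \<in> {..r} then d i - p else 0)"
    by simp
  also have "\<dots> = (\<Sum>i\<in>{1..N} \<inter> {..r}. d i - p)" by (rule sum.inter_restrict[symmetric]) simp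
  also have "\<dots> = (\<Sum>i=1..r. d i) - r * p" unfolding int by (simp add: sum_subtractf)
  finally have eq: "(\<Sum>i=1..N. if i \<le> r then d i - p else 0) = (\<Sum>i=1..r. d i) - r * p" .
  have "(\<Sum>i=1..N. d i * c i) \<le> (\<Sum>i=1..N. (if i \<le> r then d i - p else 0) + p * c i)"
    by (rule sum_mono) (rule le)
  also have "\<dots> = (\<Sum>i=1..r. d i) - r * p + p * (\<Sum>i=1..N. c i)"
    by (simp only: sum.distrib eq sum_distrib_left)
  also have "\<dots> \<le> (\<Sum>i=1..r. d i)"
    using mult_left_mono[OF csum p0] by (simp add: mult.commute)
  finally show ?thesis using True by simp
qed

subsection \<open>Positive operators of bounded trace\<close>

text \<open>Positive trace-class operators, with the trace tested on finite orthonormal families so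
  that no basis has to be fixed. Continuity of \<open>C\<close> is a consequence of these
  axioms.\<close>

locale trace_bounded_form =
  fixes C :: "'h::{real_inner, complete_space} \<Rightarrow> 'h" and B :: real
  assumes lin: "linear C"
    and sym: "inner (C h) g = inner h (C g)"
    and pos: "0 \<le> inner (C h) h"
    and trace: "orthonormal_family F \<Longrightarrow> (\<Sum>v\<in>F. inner (C v) v) \<le> B"
begin

section \<open>Cauchy-Schwarz for the form and continuity of the operator\<close>

lemma form_cauchy_schwarz: "(inner (C h) g)\<^sup>2 \<le> inner (C h) h * inner (C g) g"
proof -
  interpret linear C by (rule lin)
  have quad: "0 \<le> inner (C h) h + 2 * t * inner (C h) g + t\<^sup>2 * inner (C g) g" for t
  proof -
    have "inner (C (h + t *\<^sub>R g)) (h + t *\<^sub>R g)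
        = inner (C h) h + 2 * t * inner (C h) g + t\<^sup>2 * inner (C g) g"
      using sym[of g h] by (simp add: add scaleR inner_add_left inner_add_right inner_commute
          power2_eq_square algebra_simps)
    then show ?thesis using pos[of "h + t *\<^sub>R g"] by simp
  qed
  show ?thesis
  proof (cases "inner (C g) g = 0")
    case True
    have "inner (C h) g = 0"
    proof (rule ccontr)
      assume n: "inner (C h) g \<noteq> 0"
      \<comment> \<open>When the form vanishes at \<open>g\<close>, the quadratic is affine in
        \<open>t\<close>; the chosen \<open>t\<close> gives it the value -1.\<close>
      show False
        using quad[of "- (inner (C h) h + 1) / (2 * inner (C h) g)"] True n by (simp add: field_simps)
    qed
    then show ?thesis using True by simp
  next
    case False
    then have "0 < inner (C g) g" using pos[of g] by simp
    then show ?thesis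
      using quad[of "- inner (C h) g / inner (C g) g"]
      by (simp add: power2_eq_square field_simps)
  qed
qed

lemma form_scale:
  assumes "h \<noteq> 0"
  shows "inner (C (h /\<^sub>R norm h)) (h /\<^sub>R norm h) = inner (C h) h / (norm h)\<^sup>2"
  using assms by (simp add: linear_scale[OF lin] power2_eq_square field_simps)

lemma trace_single: "inner (C h) h \<le> B * (norm h)\<^sup>2"
proof (cases "h = 0")
  case False
  then have "orthonormal_family {h /\<^sub>R norm h}"
    by (simp add: orthonormal_family_def power2_norm_eq_inner[symmetric] power2_eq_square)
  from trace[OF this] have "inner (C h) h / (norm h)\<^sup>2 \<le> B"
    unfolding form_scale[OF False, symmetric] by simp
  then show ?thesis using False by (simp add: divide_le_eq)
qed simp

lemma bound_nonneg: "0 \<le> B"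
  using trace[of "{}"] by (simp add: orthonormal_family_def)

text \<open>Cauchy-Schwarz for the form with \<open>g = C h\<close>, then cancellation of
  \<open>(norm (C h))\<^sup>2\<close>. The form bound is asked only at the vector
  \<open>C h\<close>, so \<open>M\<close> may also be a bound valid just on an invariant
  subspace.\<close>

lemma norm_image_le: "(norm (C h))\<^sup>2 \<le> M * inner (C h) h"
  if "inner (C (C h)) (C h) \<le> M * (norm (C h))\<^sup>2"
proof (cases "C h = 0")
  case False
  have "((norm (C h))\<^sup>2)\<^sup>2 \<le> inner (C h) h * inner (C (C h)) (C h)"
    using form_cauchy_schwarz[of h "C h"] by (simp add: power2_norm_eq_inner)
  also have "\<dots> \<le> inner (C h) h * (M * (norm (C h))\<^sup>2)"
    using that pos by (intro mult_left_mono)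
  finally show ?thesis using False by (simp add: power2_eq_square field_simps)
qed simp

lemma norm_image_bound: "norm (C h) \<le> B * norm h"
proof -
  have "(norm (C h))\<^sup>2 \<le> B * inner (C h) h" by (rule norm_image_le[OF trace_single])
  also have "\<dots> \<le> B * (B * (norm h)\<^sup>2)" by (intro mult_left_mono trace_single bound_nonneg)
  also have "\<dots> = (B * norm h)\<^sup>2" by (simp add: power2_eq_square algebra_simps)
  finally show ?thesis by (rule power2_le_imp_le) (use bound_nonneg in simp)
qed

lemma bounded_linear: "bounded_linear C"
  by (rule bounded_linear_intro[of _ B])
    (use norm_image_bound in \<open>auto simp: linear_add[OF lin] linear_scale[OF lin] mult.commute\<close>)

text \<open>Take for \<open>G\<close> a family whose trace is within \<open>e\<close> of the supremum: it cannot be enlarged by a unit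
  vector with form above \<open>e\<close>.\<close>

lemma small_form_off_finite_family:
  assumes "e > 0"
  shows "\<exists>G. orthonormal_family G \<and>
    (\<forall>h. (\<forall>v\<in>G. inner h v = 0) \<longrightarrow> inner (C h) h \<le> e * (norm h)\<^sup>2)"
proof -
  define T where "T = (\<lambda>F. \<Sum>v\<in>F. inner (C v) v) ` Collect orthonormal_family"
  have ne: "T \<noteq> {}"
    unfolding T_def by (auto simp: orthonormal_family_def intro: exI[of _ "{}"])
  have bb: "bdd_above T" unfolding T_def using trace by (intro bdd_aboveI2[of _ _ B]) auto
  have "Sup T - e < Sup T" using assms by simp
  then obtain G where G: "orthonormal_family G" "Sup T - e < (\<Sum>v\<in>G. inner (C v) v)"
    unfolding less_cSup_iff[OF ne bb] by (auto simp: T_def)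
  have "inner (C h) h \<le> e * (norm h)\<^sup>2" if h: "\<forall>v\<in>G. inner h v = 0" for h
  proof (cases "h = 0")
    case False
    define u where "u = h /\<^sub>R norm h"
    have u: "norm u = 1" "\<forall>v\<in>G. inner u v = 0" using False h by (auto simp: u_def)
    note ins = orthonormal_family_insert[OF G(1) u]
    have "(\<Sum>v\<in>insert u G. inner (C v) v) \<le> Sup T"
      using ins(1) bb unfolding T_def by (intro cSup_upper) auto
    then have "inner (C u) u \<le> e"
      using G ins(2) by (simp add: orthonormal_family_finite)
    then show ?thesis
      using False unfolding u_def form_scale[OF False] by (simp add: divide_le_eq)
  qed simp
  then show ?thesis using G(1) by blast
qed

text \<open>Total boundedness: up to a small error the image of the ball is that of a finite-dimensional
  cube.\<close>

lemma compact_closure_image_cball: "compact (closure (C ` cball 0 1))"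
proof -
  have "\<exists>k. finite k \<and> closure (C ` cball 0 1) \<subseteq> (\<Union>x\<in>k. ball x e)" if e: "e > 0" for e
  proof -
    \<comment> \<open>Chosen so that \<open>B * d \<le> (e/4)\<^sup>2\<close>; the added 1 keeps the
      denominator positive when \<open>B = 0\<close>.\<close>
    define d where "d = (e/4)\<^sup>2 / (B + 1)"
    have d: "d > 0" using e bound_nonneg by (simp add: d_def)
    obtain G where G: "orthonormal_family G"
      "\<And>h. (\<forall>v\<in>G. inner h v = 0) \<Longrightarrow> inner (C h) h \<le> d * (norm h)\<^sup>2"
      using small_form_off_finite_family[OF d] by blast
    \<comment> \<open>The coefficients are bounded at every vector, not only on \<open>F\<close>, so
      \<open>a(x := t)\<close> stays admissible and the set grows as a Minkowski sum of compact
      sets.\<close>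
    have "compact {\<Sum>v\<in>F. a v *\<^sub>R C v | a. \<forall>v. \<bar>a v\<bar> \<le> (1::real)}" if "finite F" for F
      using that
    proof (induction F)
      case empty
      have "{\<Sum>v\<in>{}. a v *\<^sub>R C v | a. \<forall>v. \<bar>a v\<bar> \<le> (1::real)} = {0}"
        by (auto intro: exI[of _ "\<lambda>_. 0"])
      then show ?case by simp
    next
      case (insert x F)
      have cx: "compact ((\<lambda>t. t *\<^sub>R C x) ` {-1..1::real})"
        by (intro compact_continuous_image continuous_intros) auto
      have "{\<Sum>v\<in>insert x F. a v *\<^sub>R C v | a. \<forall>v. \<bar>a v\<bar> \<le> (1::real)}
        = {p + q | p q. p \<in> (\<lambda>t. t *\<^sub>R C x) ` {-1..1::real} \<and>
            q \<in> {\<Sum>v\<in>F. a v *\<^sub>R C v | a. \<forall>v. \<bar>a v\<bar> \<le> (1::real)}}" (is "?L = ?R")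
      proof (intro set_eqI iffI)
        fix y assume "y \<in> ?L"
        then obtain a where a: "y = a x *\<^sub>R C x + (\<Sum>v\<in>F. a v *\<^sub>R C v)" "\<forall>v. \<bar>a v\<bar> \<le> 1"
          using insert by auto
        then have "a x *\<^sub>R C x \<in> (\<lambda>t. t *\<^sub>R C x) ` {-1..1::real}"
          by (intro imageI) (simp add: abs_le_iff minus_le_iff)
        with a show "y \<in> ?R" by blast
      next
        fix y assume "y \<in> ?R"
        then obtain t a where a: "y = t *\<^sub>R C x + (\<Sum>v\<in>F. a v *\<^sub>R C v)"
          "\<forall>v. \<bar>a v\<bar> \<le> 1" "-1 \<le> t" "t \<le> 1" by auto
        have "(\<Sum>v\<in>F. a v *\<^sub>R C v) = (\<Sum>v\<in>F. (a(x := t)) v *\<^sub>R C v)"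
          using insert by (intro sum.cong) auto
        then have "y = (\<Sum>v\<in>insert x F. (a(x := t)) v *\<^sub>R C v)" using a insert by simp
        moreover have "\<forall>v. \<bar>(a(x := t)) v\<bar> \<le> 1" using a by auto
        ultimately show "y \<in> ?L" by blast
      qed
      then show ?case using compact_sums[OF cx insert.IH] by simp
    qed
    from this[of G] have K: "compact {\<Sum>v\<in>G. a v *\<^sub>R C v | a. \<forall>v. \<bar>a v\<bar> \<le> (1::real)}" (is "compact ?K")
      using G(1) by (simp add: orthonormal_family_finite)
    then have "\<forall>e>0. \<exists>k. finite k \<and> ?K \<subseteq> (\<Union>x\<in>k. ball x e)"
      unfolding compact_eq_totally_bounded by (rule conjunct2)
    from this[rule_format, OF half_gt_zero[OF e]]
    obtain k where k: "finite k" "?K \<subseteq> (\<Union>x\<in>k. ball x (e/2))" by (elim exE conjE)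
    \<comment> \<open>Half of \<open>e\<close> comes from the net and a quarter from the part of
      \<open>h\<close> off \<open>G\<close>; staying below \<open>e\<close> leaves room for the
      closure.\<close>
    have "\<exists>x\<in>k. dist x (C h) \<le> 3/4 * e" if h: "norm h \<le> 1" for h
    proof -
      define r where "r = h - proj_on G h"
      have coef: "\<bar>inner h v\<bar> \<le> 1" if "v \<in> G" for v
        using Cauchy_Schwarz_ineq2[of h v] h orthonormal_family_norm[OF G(1) that] by simp
      \<comment> \<open>The value 0 off \<open>G\<close> keeps the coefficients within the bound
        required at every vector.\<close>
      have "C (proj_on G h) = (\<Sum>v\<in>G. (if v \<in> G then inner h v else 0) *\<^sub>R C v)"
        by (simp add: proj_on_def linear_sum[OF lin] linear_scale[OF lin])
      moreover have "\<forall>v. \<bar>if v \<in> G then inner h v else 0\<bar> \<le> 1" using coef by auto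
      ultimately have "C (proj_on G h) \<in> ?K"
        by (intro CollectI exI[of _ "\<lambda>v. if v \<in> G then inner h v else 0"] conjI)
      then obtain x where x: "x \<in> k" "dist x (C (proj_on G h)) < e/2" using k(2) by auto
      have rn: "(norm r)\<^sup>2 \<le> 1"
      proof -
        have "(norm r)\<^sup>2 \<le> (norm h)\<^sup>2"
          using norm_proj_decomp[OF G(1), of h] by (simp add: r_def sum_nonneg)
        also have "\<dots> \<le> 1" using h by (simp add: power_le_one)
        finally show ?thesis .
      qed
      have "(norm (C r))\<^sup>2 \<le> B * inner (C r) r" by (rule norm_image_le[OF trace_single])
      also have "\<dots> \<le> B * (d * (norm r)\<^sup>2)"
        using G by (intro mult_left_mono bound_nonneg G(2)) (auto simp: r_def inner_resid_proj)
      also have "\<dots> \<le> B * (d * 1)" using rn d bound_nonneg by (intro mult_left_mono) auto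
      also have "\<dots> \<le> (e/4)\<^sup>2"
        using bound_nonneg unfolding d_def by (simp add: field_simps mult_right_mono)
      finally have "(norm (C r))\<^sup>2 \<le> (e/4)\<^sup>2" .
      then have "norm (C r) \<le> e/4" by (rule power2_le_imp_le) (use e in simp)
      moreover have "C h = C (proj_on G h) + C r" by (simp add: r_def linear_diff[OF lin])
      ultimately have "dist (C (proj_on G h)) (C h) \<le> e/4" by (simp add: dist_norm)
      with x(2) dist_triangle[of x "C h" "C (proj_on G h)"] have "dist x (C h) \<le> 3/4 * e" by simp
      with x(1) show ?thesis by blast
    qed
    then have "C ` cball 0 1 \<subseteq> (\<Union>x\<in>k. cball x (3/4*e))" by (auto simp: dist_commute)
    moreover have "closed (\<Union>x\<in>k. cball x (3/4*e))" using k(1) by (intro closed_UN) auto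
    ultimately have "closure (C ` cball 0 1) \<subseteq> (\<Union>x\<in>k. cball x (3/4*e))"
      by (rule closure_minimal)
    also have "\<dots> \<subseteq> (\<Union>x\<in>k. ball x e)" using e by (intro UN_mono) auto
    finally show ?thesis using k(1) by blast
  qed
  then show ?thesis unfolding compact_eq_totally_bounded complete_eq_closed by simp
qed

text \<open>The supremum of the quadratic form over the unit sphere of an invariant closed subspace,
  when positive, is attained at an eigenvector: a maximizing sequence consists of approximate
  eigenvectors, and compactness provides a limit.\<close>

lemma eigenvector_in_complement:
  assumes F: "\<And>v. v \<in> F \<Longrightarrow> \<exists>\<mu>. C v = \<mu> *\<^sub>R v"
    and t: "t > 0"
    and h0: "\<forall>v\<in>F. inner h0 v = 0" "h0 \<noteq> 0" "t * (norm h0)\<^sup>2 \<le> inner (C h0) h0"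
  shows "\<exists>e \<mu>. norm e = 1 \<and> t \<le> \<mu> \<and> C e = \<mu> *\<^sub>R e \<and> (\<forall>v\<in>F. inner e v = 0)"
proof -
  define S where "S = {u. norm u = 1 \<and> (\<forall>v\<in>F. inner u v = 0)}"
  define R where "R = (\<lambda>u. inner (C u) u) ` S"
  define L where "L = Sup R"
  have "inner (C u) u \<le> B" if "u \<in> S" for u
    using trace_single[of u] that by (simp add: S_def)
  then have bb: "bdd_above R" unfolding R_def by (rule bdd_aboveI2)
  have nS: "h /\<^sub>R norm h \<in> S" if "\<forall>v\<in>F. inner h v = 0" "h \<noteq> 0" for h
    using that by (auto simp: S_def)
  have Lb: "inner (C h) h \<le> L * (norm h)\<^sup>2" if "\<forall>v\<in>F. inner h v = 0" for h
  proof (cases "h = 0")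
    case False
    have "inner (C (h /\<^sub>R norm h)) (h /\<^sub>R norm h) \<in> R"
      unfolding R_def by (rule imageI[OF nS[OF that False]])
    then have "inner (C (h /\<^sub>R norm h)) (h /\<^sub>R norm h) \<le> L"
      unfolding L_def using bb by (rule cSup_upper)
    then show ?thesis using False unfolding form_scale[OF False] by (simp add: divide_le_eq)
  qed (simp add: linear_0[OF lin])
  have "t * (norm h0)\<^sup>2 \<le> L * (norm h0)\<^sup>2" using h0(3) Lb[OF h0(1)] by simp
  then have tL: "t \<le> L" using h0(2) by simp
  have RN: "R \<noteq> {}" using nS[OF h0(1,2)] by (auto simp: R_def)
  have "\<exists>u\<in>S. L - 1 / Suc n < inner (C u) u" for n
  proof -
    have "L - 1 / Suc n < Sup R" by (simp add: L_def)
    then show ?thesis unfolding less_cSup_iff[OF RN bb] by (auto simp: R_def)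
  qed
  then obtain u where u: "\<And>n. u n \<in> S" "\<And>n. L - 1 / Suc n < inner (C (u n)) (u n)" by metis
  \<comment> \<open>On the complement the form is bounded by \<open>L\<close>, so
    \<open>norm_image_le\<close> bounds the squared defect by
    \<open>L * (L - inner (C (u n)) (u n))\<close>.\<close>
  have approx: "(norm (C (u n) - L *\<^sub>R u n))\<^sup>2 \<le> L * (1 / Suc n)" for n
  proof -
    have un: "inner (u n) (u n) = 1" "\<forall>v\<in>F. inner (u n) v = 0"
      using u(1)[of n] by (auto simp: S_def norm_eq_1)
    \<comment> \<open>Symmetry and the eigenvector property of \<open>v\<close> keep
      \<open>C (u n)\<close> in the complement, where \<open>Lb\<close> applies.\<close>
    have "inner (C (u n)) v = 0" if "v \<in> F" for v
      using F[OF that] un(2) that by (auto simp: sym)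
    then have "(norm (C (u n)))\<^sup>2 \<le> L * inner (C (u n)) (u n)"
      by (intro norm_image_le Lb) auto
    moreover have "(norm (C (u n) - L *\<^sub>R u n))\<^sup>2
        = (norm (C (u n)))\<^sup>2 - 2 * L * inner (C (u n)) (u n) + L * L"
      using un by (simp add: power2_norm_eq_inner inner_diff_left inner_diff_right inner_commute
          algebra_simps)
    moreover have "L * (L - 1 / Suc n) \<le> L * inner (C (u n)) (u n)"
      using u(2)[of n] tL t by (intro mult_left_mono) auto
    ultimately show ?thesis by (simp add: algebra_simps)
  qed
  have "(\<lambda>n. L * (1 / real (Suc n))) \<longlonglongrightarrow> L * 0"
    by (rule tendsto_mult[OF tendsto_const LIMSEQ_Suc[OF lim_1_over_n]])
  then have lim0: "(\<lambda>n. L * (1 / real (Suc n))) \<longlonglongrightarrow> 0" by simp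
  have "(\<lambda>n. (norm (C (u n) - L *\<^sub>R u n))\<^sup>2) \<longlonglongrightarrow> 0"
    by (rule real_tendsto_sandwich[OF _ _ tendsto_const lim0])
      (rule always_eventually, use approx in simp)+
  then have "(\<lambda>n. norm (C (u n) - L *\<^sub>R u n)) \<longlonglongrightarrow> 0"
    by (subst (asm) power_tendsto_0_iff) simp_all
  then have d0: "(\<lambda>n. C (u n) - L *\<^sub>R u n) \<longlonglongrightarrow> 0"
    by (rule tendsto_norm_zero_cancel)
  have "C (u n) \<in> closure (C ` cball 0 1)" for n
    by (rule subsetD[OF closure_subset], rule imageI) (use u(1)[of n] in \<open>simp add: S_def\<close>)
  then have "\<forall>n. C (u n) \<in> closure (C ` cball 0 1)" by simp
  with compact_closure_image_cball obtain y r where r: "strict_mono r" "((\<lambda>n. C (u n)) \<circ> r) \<longlonglongrightarrow> y"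
    unfolding compact_def by meson
  \<comment> \<open>\<open>L *\<^sub>R u (r n)\<close> differs from \<open>C (u (r n))\<close> by a
    null sequence, so the maximizing subsequence itself converges, to \<open>y\<close> divided by
    \<open>L\<close>.\<close>
  define e where "e = y /\<^sub>R L"
  have L0: "L > 0" using tL t by simp
  have "(\<lambda>n. (C (u (r n)) - (C (u (r n)) - L *\<^sub>R u (r n))) /\<^sub>R L) \<longlonglongrightarrow> (y - 0) /\<^sub>R L"
    using r(2) LIMSEQ_subseq_LIMSEQ[OF d0 r(1)] unfolding o_def
    by (intro tendsto_scaleR tendsto_const tendsto_diff)
  then have ue: "(\<lambda>n. u (r n)) \<longlonglongrightarrow> e" using L0 by (simp add: e_def)
  have "(\<lambda>n. C (u (r n))) \<longlonglongrightarrow> C e" by (rule bounded_linear.tendsto[OF bounded_linear ue])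
  moreover have "(\<lambda>n. C (u (r n))) \<longlonglongrightarrow> y" using r(2) by (simp add: o_def)
  ultimately have "C e = y" by (rule LIMSEQ_unique)
  then have "C e = L *\<^sub>R e" using L0 by (simp add: e_def)
  moreover have "norm e = 1"
    using tendsto_norm[OF ue] u(1) by (simp add: S_def LIMSEQ_const_iff)
  moreover have "inner e v = 0" if "v \<in> F" for v
  proof -
    have "(\<lambda>n. inner (u (r n)) v) \<longlonglongrightarrow> inner e v" by (intro tendsto_intros ue)
    then show ?thesis using u(1) that by (simp add: S_def LIMSEQ_const_iff)
  qed
  ultimately show ?thesis using tL by blast
qed

section \<open>Finite eigenfamilies above a positive level\<close>

definition eigen_family :: "real \<Rightarrow> 'h set \<Rightarrow> bool" where
  "eigen_family t F \<longleftrightarrow> orthonormal_family F \<and>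
     (\<forall>v\<in>F. C v = inner (C v) v *\<^sub>R v \<and> t \<le> inner (C v) v)"

text \<open>In effect an orthonormal basis of all eigenspaces with eigenvalue at least
  \<open>t\<close>, encoded by a bound on the complement. The strict inequality excludes a further
  eigenvector with eigenvalue exactly \<open>t\<close>.\<close>

definition complete_eigen_family :: "real \<Rightarrow> 'h set \<Rightarrow> bool" where
  "complete_eigen_family t F \<longleftrightarrow> eigen_family t F \<and>
     (\<forall>h. (\<forall>v\<in>F. inner h v = 0) \<longrightarrow> h \<noteq> 0 \<longrightarrow> inner (C h) h < t * (norm h)\<^sup>2)"

text \<open>The trace bounds the cardinality of an eigenfamily at a level \<open>t > 0\<close>; one of maximal
  cardinality is complete.\<close>

lemma complete_eigen_family_exists:
  assumes t: "t > 0"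
  shows "\<exists>F. complete_eigen_family t F"
proof -
  have bound: "card F \<le> nat \<lfloor>B / t\<rfloor>" if "eigen_family t F" for F
  proof -
    have "t \<le> inner (C v) v" if "v \<in> F" for v
      using \<open>eigen_family t F\<close> that unfolding eigen_family_def by blast
    then have "(\<Sum>v\<in>F. t) \<le> (\<Sum>v\<in>F. inner (C v) v)" by (rule sum_mono)
    then have "card F * t \<le> (\<Sum>v\<in>F. inner (C v) v)" by simp
    also have "\<dots> \<le> B" using that trace unfolding eigen_family_def by blast
    finally have "real (card F) \<le> B / t" using t by (simp add: field_simps)
    then show ?thesis using le_nat_floor by blast
  qed
  have "eigen_family t {}" by (simp add: eigen_family_def orthonormal_family_def)
  then have "\<exists>F. eigen_family t F \<and> (\<forall>G. eigen_family t G \<longrightarrow> card G \<le> card F)"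
    by (rule ex_has_greatest_nat[of "eigen_family t" "{}" card "Suc (nat \<lfloor>B / t\<rfloor>)"])
      (intro allI impI le_imp_less_Suc bound)
  then obtain F where F: "eigen_family t F" "\<And>G. eigen_family t G \<Longrightarrow> card G \<le> card F"
    by blast
  have on: "orthonormal_family F" using F unfolding eigen_family_def by blast
  have "inner (C h) h < t * (norm h)\<^sup>2" if h: "\<forall>v\<in>F. inner h v = 0" "h \<noteq> 0" for h
  proof (rule ccontr)
    \<comment> \<open>Such a vector would supply a further eigenvector orthogonal to
      \<open>F\<close>, hence a larger eigenfamily.\<close>
    assume "\<not> ?thesis"
    then have ge: "t * (norm h)\<^sup>2 \<le> inner (C h) h" by simp
    have "\<exists>e \<mu>. norm e = 1 \<and> t \<le> \<mu> \<and> C e = \<mu> *\<^sub>R e \<and> (\<forall>v\<in>F. inner e v = 0)"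
      by (rule eigenvector_in_complement[OF _ t h ge]) (use F(1) in \<open>unfold eigen_family_def, blast\<close>)
    then obtain e \<mu> where e: "norm e = 1" "t \<le> \<mu>" "C e = \<mu> *\<^sub>R e" "\<forall>v\<in>F. inner e v = 0"
      by (elim exE conjE)
    note ins = orthonormal_family_insert[OF on e(1,4)]
    have mu: "inner (C e) e = \<mu>" using e(1,3) by (simp add: norm_eq_1)
    have "C e = inner (C e) e *\<^sub>R e \<and> t \<le> inner (C e) e" unfolding mu using e(2,3) by simp
    then have "eigen_family t (insert e F)" using F(1) ins(1) unfolding eigen_family_def by blast
    then have "card (insert e F) \<le> card F" by (rule F(2))
    then show False using ins(2) orthonormal_family_finite[OF on] by simp
  qed
  then show ?thesis using F(1) unfolding complete_eigen_family_def by blast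
qed

text \<open>\<open>C\<close> maps the span of \<open>F\<close> into itself and the residual is
  orthogonal to that span, so the mixed terms vanish.\<close>

lemma form_eigen_decomp:
  assumes F: "eigen_family t F"
  shows "inner (C h) h = (\<Sum>v\<in>F. inner (C v) v * (inner h v)\<^sup>2)
    + inner (C (h - proj_on F h)) (h - proj_on F h)"
proof -
  have on: "orthonormal_family F" using F unfolding eigen_family_def by blast
  let ?p = "proj_on F h" and ?r = "h - proj_on F h"
  have Cp: "C ?p = (\<Sum>v\<in>F. (inner h v * inner (C v) v) *\<^sub>R v)"
    unfolding proj_on_def linear_sum[OF lin] linear_scale[OF lin]
  proof (rule sum.cong[OF refl])
    fix v assume "v \<in> F"
    then have "C v = inner (C v) v *\<^sub>R v" using F unfolding eigen_family_def by blast
    then show "inner h v *\<^sub>R C v = (inner h v * inner (C v) v) *\<^sub>R v"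
      by (metis scaleR_scaleR)
  qed
  have "inner (C ?p) ?r = (\<Sum>v\<in>F. (inner h v * inner (C v) v) * inner v ?r)"
    unfolding Cp by (simp only: inner_sum_left inner_scaleR_left)
  also have "\<dots> = 0"
    by (rule sum.neutral, rule ballI, subst inner_commute) (simp add: inner_resid_proj[OF on])
  finally have pr: "inner (C ?p) ?r = 0" .
  have "inner (C ?p) ?p = (\<Sum>v\<in>F. (inner h v * inner (C v) v) * inner v ?p)"
    unfolding Cp by (simp only: inner_sum_left inner_scaleR_left)
  also have "\<dots> = (\<Sum>v\<in>F. inner (C v) v * (inner h v)\<^sup>2)"
    by (intro sum.cong refl)
      (simp only: inner_commute[of _ ?p] inner_proj_on[OF on] power2_eq_square mult_ac)
  finally have pp: "inner (C ?p) ?p = (\<Sum>v\<in>F. inner (C v) v * (inner h v)\<^sup>2)" .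
  have "inner (C (?p + ?r)) (?p + ?r) = inner (C ?p) ?p + inner (C ?r) ?r"
    using pr sym[of ?r ?p] unfolding linear_add[OF lin]
    by (simp only: inner_add_left inner_add_right inner_commute[of ?r])
  then show ?thesis unfolding pp by simp
qed

text \<open>By symmetry an eigenvector has no component along members with another eigenvalue. Its
  residual off \<open>F\<close> again satisfies the eigenvalue equation with
  \<open>\<mu> \<ge> t\<close>, so completeness forces it to be 0.\<close>

lemma eigenspace_eq_span:
  assumes F: "complete_eigen_family t F" and \<mu>: "t \<le> \<mu>"
  shows "op_eigenspace C \<mu> = span {v\<in>F. inner (C v) v = \<mu>}"
proof
  have on: "orthonormal_family F" and ev: "\<And>v. v \<in> F \<Longrightarrow> C v = inner (C v) v *\<^sub>R v"
    using F unfolding complete_eigen_family_def eigen_family_def by blast+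
  have sub: "subspace (op_eigenspace C \<mu>)"
    by (auto simp: op_eigenspace_def subspace_def linear_0[OF lin] linear_add[OF lin]
        linear_scale[OF lin] scaleR_add_right)
  show "span {v\<in>F. inner (C v) v = \<mu>} \<subseteq> op_eigenspace C \<mu>"
    by (rule span_minimal[OF _ sub]) (clarify, unfold op_eigenspace_def mem_Collect_eq, rule ev)
  show "op_eigenspace C \<mu> \<subseteq> span {v\<in>F. inner (C v) v = \<mu>}"
  proof
    fix x assume "x \<in> op_eigenspace C \<mu>"
    then have x: "C x = \<mu> *\<^sub>R x" by (simp add: op_eigenspace_def)
    have coef: "inner x v *\<^sub>R C v = \<mu> *\<^sub>R (inner x v *\<^sub>R v)
        \<and> (inner (C v) v \<noteq> \<mu> \<longrightarrow> inner x v = 0)" if v: "v \<in> F" for v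
    proof -
      have "inner (C v) v * inner x v = inner x (C v)" by (subst (2) ev[OF v]) simp
      also have "\<dots> = \<mu> * inner x v" using sym[of x v] x by simp
      finally have "inner (C v) v = \<mu> \<or> inner x v = 0" by auto
      then show ?thesis
      proof
        assume eq: "inner (C v) v = \<mu>"
        have "C v = \<mu> *\<^sub>R v" by (subst ev[OF v]) (simp only: eq)
        then show ?thesis using eq by (simp add: mult.commute)
      qed simp
    qed
    have "C (proj_on F x) = \<mu> *\<^sub>R proj_on F x"
      unfolding proj_on_def linear_sum[OF lin] linear_scale[OF lin] scaleR_sum_right
      by (rule sum.cong) (use coef in auto)
    then have Cr: "C (x - proj_on F x) = \<mu> *\<^sub>R (x - proj_on F x)"
      by (simp add: linear_diff[OF lin] x scaleR_diff_right)
    have "x - proj_on F x = 0"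
    proof (rule ccontr)
      assume n: "x - proj_on F x \<noteq> 0"
      have "inner (C (x - proj_on F x)) (x - proj_on F x) < t * (norm (x - proj_on F x))\<^sup>2"
        using F n inner_resid_proj[OF on] unfolding complete_eigen_family_def by blast
      then show False using Cr \<mu> n
        by (simp add: power2_norm_eq_inner[symmetric])
    qed
    then have "x = (\<Sum>v\<in>F. inner x v *\<^sub>R v)" by (simp add: proj_on_def)
    also have "\<dots> = (\<Sum>v\<in>{v\<in>F. inner (C v) v = \<mu>}. inner x v *\<^sub>R v)"
      by (rule sum.mono_neutral_right) (use coef orthonormal_family_finite[OF on] in auto)
    also have "\<dots> \<in> span {v\<in>F. inner (C v) v = \<mu>}"
      by (intro span_sum span_scale span_base)
    finally show "x \<in> span {v\<in>F. inner (C v) v = \<mu>}" .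
  qed
qed

section \<open>The decreasing list of eigenvalues\<close>

lemma eig_count_eq_card:
  assumes F: "complete_eigen_family t F" and t: "t > 0" and s: "t \<le> s"
  shows "eig_count C s = card {v\<in>F. s \<le> inner (C v) v}"
proof -
  let ?ev = "\<lambda>v. inner (C v) v"
  have on: "orthonormal_family F" and ev: "\<And>v. v \<in> F \<Longrightarrow> C v = inner (C v) v *\<^sub>R v"
    using F unfolding complete_eigen_family_def eigen_family_def by blast+
  have fin: "finite {v\<in>F. s \<le> ?ev v}" using orthonormal_family_finite[OF on] by simp
  have dim: "dim (op_eigenspace C \<mu>) = card {v\<in>F. ?ev v = \<mu>}" if "s \<le> \<mu>" for \<mu>
  proof -
    have "independent {v\<in>F. ?ev v = \<mu>}"
      by (rule orthonormal_family_independent, rule orthonormal_family_subset[OF on]) auto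
    then show ?thesis
      unfolding eigenspace_eq_span[OF F order_trans[OF s that]] by (rule dim_span_eq_card_independent)
  qed
  \<comment> \<open>This makes the index set in \<open>eig_count\<close> finite; over an infinite
    set the sum would default to 0.\<close>
  have vals: "{\<mu>\<in>op_eigenvalues C. s \<le> \<mu>} = ?ev ` {v\<in>F. s \<le> ?ev v}"
  proof (intro set_eqI iffI)
    fix \<mu> assume "\<mu> \<in> {\<mu>\<in>op_eigenvalues C. s \<le> \<mu>}"
    then obtain v where v: "v \<noteq> 0" "C v = \<mu> *\<^sub>R v" "s \<le> \<mu>" by (auto simp: op_eigenvalues_def)
    then have "v \<in> span {v\<in>F. ?ev v = \<mu>}"
      using eigenspace_eq_span[OF F, of \<mu>] s by (auto simp: op_eigenspace_def)
    then have "{v\<in>F. ?ev v = \<mu>} \<noteq> {}" using v(1) by (metis singletonD span_empty)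
    then show "\<mu> \<in> ?ev ` {v\<in>F. s \<le> ?ev v}" using v(3) by auto
  next
    fix \<mu> assume "\<mu> \<in> ?ev ` {v\<in>F. s \<le> ?ev v}"
    then obtain v where v: "v \<in> F" "\<mu> = ?ev v" "s \<le> \<mu>" by auto
    have "v \<noteq> 0" using orthonormal_family_norm[OF on v(1)] by auto
    moreover have "C v = \<mu> *\<^sub>R v" by (subst v(2)) (rule ev[OF v(1)])
    ultimately show "\<mu> \<in> {\<mu>\<in>op_eigenvalues C. s \<le> \<mu>}"
      using v(3) unfolding op_eigenvalues_def by blast
  qed
  have "eig_count C s = (\<Sum>\<mu>\<in>?ev ` {v\<in>F. s \<le> ?ev v}. card {v\<in>F. ?ev v = \<mu>})"
    unfolding eig_count_def vals by (rule sum.cong) (auto simp: dim)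
  also have "\<dots> = (\<Sum>\<mu>\<in>?ev ` {v\<in>F. s \<le> ?ev v}.
      \<Sum>v\<in>{x\<in>{v\<in>F. s \<le> ?ev v}. ?ev x = \<mu>}. 1)"
    by (rule sum.cong) (auto intro!: arg_cong[of _ _ card])
  also have "\<dots> = (\<Sum>v\<in>{v\<in>F. s \<le> ?ev v}. 1)"
    by (rule sum.image_gen[OF fin, symmetric])
  finally show ?thesis by simp
qed

text \<open>Passes from the \<open>Sup\<close> definition to a sorted eigenfamily. Beyond the family
  only the bounds 0 and \<open>t\<close> remain, which is enough once \<open>t\<close> tends to
  0.\<close>

lemma op_eigenvalue_enumeration:
  assumes t: "t > 0"
  shows "\<exists>F e. complete_eigen_family t F \<and> bij_betw e {1..card F} F \<and>
    (\<forall>i j. 1 \<le> i \<longrightarrow> i \<le> j \<longrightarrow> j \<le> card F \<longrightarrow>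
      inner (C (e j)) (e j) \<le> inner (C (e i)) (e i)) \<and>
    (\<forall>i\<in>{1..card F}. op_eigenvalue C i = inner (C (e i)) (e i)) \<and>
    (\<forall>i>card F. 0 \<le> op_eigenvalue C i \<and> op_eigenvalue C i \<le> t)"
proof -
  obtain F where F: "complete_eigen_family t F" using complete_eigen_family_exists[OF t] by blast
  then have on: "orthonormal_family F" and evt: "\<And>v. v \<in> F \<Longrightarrow> t \<le> inner (C v) v"
    unfolding complete_eigen_family_def eigen_family_def by blast+
  obtain e where e: "bij_betw e {1..card F} F" and anti': "\<forall>i j. 1 \<le> i \<longrightarrow> i \<le> j \<longrightarrow>
      j \<le> card F \<longrightarrow> inner (C (e j)) (e j) \<le> inner (C (e i)) (e i)"
    using antitone_enumeration[OF orthonormal_family_finite[OF on], of "\<lambda>v. inner (C v) v"]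
    by (elim exE conjE)
  note anti = anti'[rule_format]
  define l where "l i = inner (C (e i)) (e i)" for i
  have cnt: "eig_count C s = card {i\<in>{1..card F}. s \<le> l i}" if "t \<le> s" for s
  proof -
    have "e ` {i\<in>{1..card F}. s \<le> l i} = {v\<in>F. s \<le> inner (C v) v}"
    proof (intro subset_antisym subsetI)
      fix v assume "v \<in> e ` {i\<in>{1..card F}. s \<le> l i}"
      then obtain i where i: "i \<in> {1..card F}" "s \<le> l i" "v = e i" by blast
      then show "v \<in> {v\<in>F. s \<le> inner (C v) v}"
        using bij_betwE[OF e, rule_format, OF i(1)] by (simp add: l_def)
    next
      fix v assume v: "v \<in> {v\<in>F. s \<le> inner (C v) v}"
      then have "v \<in> e ` {1..card F}" using bij_betw_imp_surj_on[OF e] by simp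
      then show "v \<in> e ` {i\<in>{1..card F}. s \<le> l i}" using v unfolding l_def by blast
    qed
    then have "bij_betw e {i\<in>{1..card F}. s \<le> l i} {v\<in>F. s \<le> inner (C v) v}"
      by (intro bij_betw_subset[OF e]) auto
    from bij_betw_same_card[OF this] show ?thesis by (simp add: eig_count_eq_card[OF F t that])
  qed
  have cnt_le: "eig_count C s \<le> card F" if "t \<le> s" for s
  proof -
    have "card {i\<in>{1..card F}. s \<le> l i} \<le> card {1..card F}" by (rule card_mono) auto
    then show ?thesis by (simp add: cnt[OF that])
  qed
  \<comment> \<open>In a decreasing list at least \<open>i\<close> entries reach \<open>s\<close>
    exactly when the entry number \<open>i\<close> does.\<close>
  have iff: "i \<le> eig_count C s \<longleftrightarrow> s \<le> l i" if i: "i \<in> {1..card F}" and s: "t \<le> s" for i s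
  proof
    assume "s \<le> l i"
    then have "s \<le> l j" if "j \<in> {1..i}" for j
      using anti[of j i] i that unfolding l_def by simp
    then have "{1..i} \<subseteq> {i\<in>{1..card F}. s \<le> l i}" using i by auto
    then have "card {1..i} \<le> card {i\<in>{1..card F}. s \<le> l i}" by (intro card_mono) auto
    then show "i \<le> eig_count C s" by (simp add: cnt[OF s])
  next
    assume a: "i \<le> eig_count C s"
    show "s \<le> l i"
    proof (rule ccontr)
      assume n: "\<not> s \<le> l i"
      have "j \<in> {1..<i}" if "j \<in> {1..card F}" "s \<le> l j" for j
        using anti[of i j] n that i unfolding l_def by force
      then have "{i\<in>{1..card F}. s \<le> l i} \<subseteq> {1..<i}" by blast
      then have "card {i\<in>{1..card F}. s \<le> l i} \<le> card {1..<i}" by (intro card_mono) auto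
      then have "eig_count C s \<le> i - 1" by (simp add: cnt[OF s])
      then show False using a i by auto
    qed
  qed
  have top: "op_eigenvalue C i = l i" if i: "i \<in> {1..card F}" for i
  proof -
    have tl: "t \<le> l i" unfolding l_def by (rule evt[OF bij_betwE[OF e, rule_format, OF i]])
    then have mem: "0 < l i \<and> i \<le> eig_count C (l i)" using iff[OF i tl] t by simp
    have "Sup {s. 0 < s \<and> i \<le> eig_count C s} = l i"
    proof (rule cSup_eq_maximum)
      show "l i \<in> {s. 0 < s \<and> i \<le> eig_count C s}" using mem by simp
      show "s \<le> l i" if "s \<in> {s. 0 < s \<and> i \<le> eig_count C s}" for s
        using iff[OF i, of s] that tl by (cases "t \<le> s") auto
    qed
    then show ?thesis using mem unfolding op_eigenvalue_def by auto
  qed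
  have rest: "0 \<le> op_eigenvalue C i \<and> op_eigenvalue C i \<le> t" if i: "i > card F" for i
  proof (cases "\<exists>s>0. i \<le> eig_count C s")
    case True
    then obtain s where s: "0 < s" "i \<le> eig_count C s" by blast
    \<comment> \<open>From level \<open>t\<close> on the count is at most \<open>card F < i\<close>,
      so no admissible \<open>s\<close> exceeds \<open>t\<close>.\<close>
    have less: "s \<le> t" if "s \<in> {s. 0 < s \<and> i \<le> eig_count C s}" for s
      using cnt_le[of s] i that by (cases "t \<le> s") auto
    have "s \<le> Sup {s. 0 < s \<and> i \<le> eig_count C s}"
      using s less by (intro cSup_upper bdd_aboveI) auto
    moreover have "Sup {s. 0 < s \<and> i \<le> eig_count C s} \<le> t"
      using s less by (intro cSup_least) auto
    ultimately show ?thesis unfolding op_eigenvalue_def if_P[OF True] using s(1) by simp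
  next
    case False
    then show ?thesis unfolding op_eigenvalue_def if_not_P[OF False] using t by simp
  qed
  show ?thesis
    by (rule exI[of _ F], rule exI[of _ e], intro conjI allI impI ballI)
      (rule F e anti top[unfolded l_def] rest[THEN conjunct1] rest[THEN conjunct2]; assumption)+
qed

section \<open>Sums of the leading eigenvalues\<close>

lemma op_eigenvalue_nonneg: "i \<ge> 1 \<Longrightarrow> 0 \<le> op_eigenvalue C i"
proof -
  assume "i \<ge> 1"
  \<comment> \<open>Any positive level would do. Index 0 has to stay out: there the set under
    \<open>Sup\<close> is that of all positive reals.\<close>
  obtain F :: "'h set" and e where "\<forall>i\<in>{1..card F}. op_eigenvalue C i = inner (C (e i)) (e i)"
    "\<forall>i>card F. 0 \<le> op_eigenvalue C i \<and> op_eigenvalue C i \<le> 1"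
    using op_eigenvalue_enumeration[OF zero_less_one] by blast
  then show ?thesis using pos \<open>i \<ge> 1\<close> by (cases "i \<le> card F") auto
qed

text \<open>Eigenvalues missed by an eigenfamily at level \<open>t\<close> add at most
  \<open>k * t\<^sup>2\<close>, and \<open>H\<close> does not depend on \<open>t\<close>.\<close>

lemma sum_power2_op_eigenvalue_le:
  assumes H: "\<And>t F. t > 0 \<Longrightarrow> eigen_family t F \<Longrightarrow> (\<Sum>v\<in>F. (inner (C v) v)\<^sup>2) \<le> H"
  shows "(\<Sum>i=1..k. (op_eigenvalue C i)\<^sup>2) \<le> H"
proof (rule field_le_epsilon)
  fix \<epsilon> :: real assume "\<epsilon> > 0"
  define t where "t = sqrt (\<epsilon> / (real k + 1))"
  have t: "t > 0" "t\<^sup>2 = \<epsilon> / (real k + 1)" using \<open>\<epsilon> > 0\<close> by (auto simp: t_def)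
  obtain F e where F: "complete_eigen_family t F" and e: "bij_betw e {1..card F} F"
    and top: "\<forall>i\<in>{1..card F}. op_eigenvalue C i = inner (C (e i)) (e i)"
    and rest: "\<forall>i>card F. 0 \<le> op_eigenvalue C i \<and> op_eigenvalue C i \<le> t"
    using op_eigenvalue_enumeration[OF t(1)] by blast
  let ?g = "\<lambda>i. (inner (C (e i)) (e i))\<^sup>2"
  have "(op_eigenvalue C i)\<^sup>2 \<le> (if i \<le> card F then ?g i else 0) + t\<^sup>2" if "i \<in> {1..k}" for i
    using that top rest t(1) by (auto simp: power_mono)
  then have "(\<Sum>i=1..k. (op_eigenvalue C i)\<^sup>2) \<le> (\<Sum>i=1..k. (if i \<le> card F then ?g i else 0) + t\<^sup>2)"
    by (rule sum_mono)
  also have "\<dots> = (\<Sum>i\<in>{1..k} \<inter> {i. i \<le> card F}. ?g i) + k * t\<^sup>2"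
    by (simp add: sum.distrib sum.If_cases)
  also have "\<dots> \<le> (\<Sum>i=1..card F. ?g i) + k * t\<^sup>2"
    by (intro add_right_mono sum_mono2) auto
  also have "(\<Sum>i=1..card F. ?g i) = (\<Sum>v\<in>F. (inner (C v) v)\<^sup>2)"
    by (rule sum.reindex_bij_betw[OF e])
  also have "\<dots> \<le> H" using F unfolding complete_eigen_family_def by (intro H[OF t(1)]) blast
  also have "k * t\<^sup>2 \<le> \<epsilon>" using \<open>\<epsilon> > 0\<close> by (simp add: t(2) field_simps)
  finally show "(\<Sum>i=1..k. (op_eigenvalue C i)\<^sup>2) \<le> H + \<epsilon>" by simp
qed

text \<open>Up to a small error the trace over \<open>U\<close> is bounded by a weighted eigenvalue
  sum. Bessel's inequality against \<open>U\<close> bounds each weight by 1, against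
  \<open>F\<close> the total weight by \<open>card U\<close>; the bathtub principle then selects the
  top eigenvalues.\<close>

lemma ky_fan_inequality:
  assumes U: "orthonormal_family U"
  shows "(\<Sum>u\<in>U. inner (C u) u) \<le> (\<Sum>i=1..card U. op_eigenvalue C i)"
proof (rule field_le_epsilon)
  fix \<epsilon> :: real assume "\<epsilon> > 0"
  define r where "r = card U"
  \<comment> \<open>Each of the \<open>r\<close> unit vectors costs an error \<open>t\<close>;
    together they stay within \<open>\<epsilon>\<close>.\<close>
  define t where "t = \<epsilon> / (real r + 1)"
  have t: "t > 0" using \<open>\<epsilon> > 0\<close> by (simp add: t_def)
  obtain F e where F: "complete_eigen_family t F" and e: "bij_betw e {1..card F} F"
    and anti: "\<forall>i j. 1 \<le> i \<longrightarrow> i \<le> j \<longrightarrow> j \<le> card F \<longrightarrow>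
      inner (C (e j)) (e j) \<le> inner (C (e i)) (e i)"
    and top: "\<forall>i\<in>{1..card F}. op_eigenvalue C i = inner (C (e i)) (e i)"
    using op_eigenvalue_enumeration[OF t] by blast
  have ef: "eigen_family t F" and on: "orthonormal_family F"
    using F unfolding complete_eigen_family_def eigen_family_def by blast+
  define l where "l i = inner (C (e i)) (e i)" for i
  define c where "c i = (\<Sum>u\<in>U. (inner u (e i))\<^sup>2)" for i
  have eF: "e i \<in> F" if "i \<in> {1..card F}" for i using e that by (auto simp: bij_betw_def)
  have lt: "t \<le> l i" if "i \<in> {1..card F}" for i
    using ef eF[OF that] unfolding eigen_family_def l_def by blast
  \<comment> \<open>The residual contributes at most \<open>t\<close> times its squared norm, which
    is 1 minus the squared coefficients; hence the constant \<open>t\<close> and the shifted factors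
    \<open>l i - t\<close>.\<close>
  have form: "inner (C u) u \<le> t + (\<Sum>i=1..card F. (l i - t) * (inner u (e i))\<^sup>2)" if "u \<in> U" for u
  proof -
    let ?r = "u - proj_on F u"
    have "inner (C ?r) ?r \<le> t * (norm ?r)\<^sup>2"
    proof (cases "?r = 0")
      case False
      then show ?thesis using F inner_resid_proj[OF on, of _ u]
        unfolding complete_eigen_family_def by (meson less_imp_le)
    qed (simp add: linear_0[OF lin])
    moreover have "(norm ?r)\<^sup>2 = 1 - (\<Sum>v\<in>F. (inner u v)\<^sup>2)"
      using norm_proj_decomp[OF on, of u] orthonormal_family_norm[OF U that] by simp
    ultimately have "inner (C u) u \<le> t + (\<Sum>v\<in>F. (inner (C v) v - t) * (inner u v)\<^sup>2)"
      using form_eigen_decomp[OF ef, of u]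
      by (simp add: left_diff_distrib sum_subtractf sum_distrib_left right_diff_distrib)
    also have "(\<Sum>v\<in>F. (inner (C v) v - t) * (inner u v)\<^sup>2)
        = (\<Sum>i=1..card F. (l i - t) * (inner u (e i))\<^sup>2)"
      unfolding l_def by (rule sum.reindex_bij_betw[OF e, symmetric])
    finally show ?thesis .
  qed
  \<comment> \<open>The bathtub lemma asks for its bounds at every index, hence the value 0 outside
    the range.\<close>
  have c1: "(if i \<in> {1..card F} then c i else 0) \<le> 1" for i
  proof (cases "i \<in> {1..card F}")
    case True
    have "c i = (\<Sum>u\<in>U. (inner (e i) u)\<^sup>2)" by (simp add: c_def inner_commute)
    also have "\<dots> \<le> (norm (e i))\<^sup>2" by (rule bessel_inequality[OF U])
    also have "\<dots> = 1" using orthonormal_family_norm[OF on eF[OF True]] by simp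
    finally show ?thesis by simp
  qed auto
  have "(\<Sum>i=1..card F. c i) = (\<Sum>u\<in>U. \<Sum>i=1..card F. (inner u (e i))\<^sup>2)"
    unfolding c_def by (rule sum.swap)
  also have "\<dots> \<le> (\<Sum>u\<in>U. 1)"
  proof (rule sum_mono)
    fix u assume u: "u \<in> U"
    have "(\<Sum>i=1..card F. (inner u (e i))\<^sup>2) = (\<Sum>v\<in>F. (inner u v)\<^sup>2)"
      by (rule sum.reindex_bij_betw[OF e])
    also have "\<dots> \<le> (norm u)\<^sup>2" by (rule bessel_inequality[OF on])
    finally show "(\<Sum>i=1..card F. (inner u (e i))\<^sup>2) \<le> 1"
      using orthonormal_family_norm[OF U u] by simp
  qed
  finally have csum: "(\<Sum>i=1..card F. c i) \<le> real r" by (simp add: r_def)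
  have "(\<Sum>u\<in>U. inner (C u) u) \<le> (\<Sum>u\<in>U. t + (\<Sum>i=1..card F. (l i - t) * (inner u (e i))\<^sup>2))"
    by (rule sum_mono) (rule form)
  also have "\<dots> = r * t + (\<Sum>i=1..card F. (l i - t) * c i)"
  proof -
    have "(\<Sum>u\<in>U. \<Sum>i=1..card F. (l i - t) * (inner u (e i))\<^sup>2) = (\<Sum>i=1..card F. (l i - t) * c i)"
      unfolding c_def sum_distrib_left by (rule sum.swap)
    then show ?thesis by (simp only: sum.distrib) (simp add: r_def)
  qed
  also have "(\<Sum>i=1..card F. (l i - t) * c i)
      = (\<Sum>i=1..card F. (l i - t) * (if i \<in> {1..card F} then c i else 0))"
    by (rule sum.cong) auto
  also have "\<dots> \<le> (\<Sum>i=1..min r (card F). l i - t)"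
    using anti lt c1 csum
    by (intro weighted_sum_le_top_sum) (auto simp: l_def c_def sum_nonneg)
  also have "\<dots> \<le> (\<Sum>i=1..min r (card F). op_eigenvalue C i)"
    using top t by (intro sum_mono) (auto simp: l_def)
  also have "\<dots> \<le> (\<Sum>i=1..r. op_eigenvalue C i)"
    by (intro sum_mono2) (auto intro: op_eigenvalue_nonneg)
  also have "r * t \<le> \<epsilon>" using \<open>\<epsilon> > 0\<close> by (simp add: t_def field_simps)
  finally show "(\<Sum>u\<in>U. inner (C u) u) \<le> (\<Sum>i=1..card U. op_eigenvalue C i) + \<epsilon>"
    by (simp add: r_def)
qed

text \<open>The left side is the trace of the weighted sum of the rank-one maps given by the
  \<open>m i\<close>, computed in an orthonormal basis of their span. This has at most
  \<open>r\<close> members, so domination by \<open>C\<close> and Ky Fan's inequality apply.\<close>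

lemma sum_norm_le_sum_op_eigenvalue:
  fixes m :: "nat \<Rightarrow> 'h"
  assumes dom: "\<And>h. (\<Sum>i=1..r. w i * (inner (m i) h)\<^sup>2) \<le> inner (C h) h"
  shows "(\<Sum>i=1..r. w i * (norm (m i))\<^sup>2) \<le> (\<Sum>i=1..r. op_eigenvalue C i)"
proof -
  obtain U where U: "orthonormal_family U" "card U \<le> card (m ` {1..r})"
    "\<forall>x\<in>m ` {1..r}. proj_on U x = x" using orthonormal_basis_exists[of "m ` {1..r}"] by auto
  have cU: "card U \<le> r" using U(2) card_image_le[of "{1..r}" m] by simp
  have n: "(norm (m i))\<^sup>2 = (\<Sum>u\<in>U. (inner (m i) u)\<^sup>2)" if "i \<in> {1..r}" for i
    using norm_proj_decomp[OF U(1), of "m i"] U(3) that by simp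
  have "(\<Sum>i=1..r. w i * (norm (m i))\<^sup>2) = (\<Sum>i=1..r. \<Sum>u\<in>U. w i * (inner (m i) u)\<^sup>2)"
    using n by (simp add: sum_distrib_left)
  also have "\<dots> = (\<Sum>u\<in>U. \<Sum>i=1..r. w i * (inner (m i) u)\<^sup>2)" by (rule sum.swap)
  also have "\<dots> \<le> (\<Sum>u\<in>U. inner (C u) u)" by (intro sum_mono dom)
  also have "\<dots> \<le> (\<Sum>i=1..card U. op_eigenvalue C i)" by (rule ky_fan_inequality[OF U(1)])
  also have "\<dots> \<le> (\<Sum>i=1..r. op_eigenvalue C i)"
    using cU by (intro sum_mono2) (auto intro: op_eigenvalue_nonneg)
  finally show ?thesis .
qed

end

subsection \<open>Integrals and Gaussian estimates\<close>

lemma integrable_bounded_borel: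
  fixes f :: "'a::topological_space \<Rightarrow> real"
  assumes "prob_space M" "sets M = sets borel" "f \<in> borel_measurable borel" "\<And>x. \<bar>f x\<bar> \<le> K"
  shows "integrable M f"
proof -
  interpret prob_space M by fact
  have "f \<in> borel_measurable M" using assms(2,3) by (simp cong: measurable_cong_sets)
  then show ?thesis by (intro integrable_const_bound[of _ K]) (use assms(4) in auto)
qed

lemma integral_bounds:
  fixes f :: "'a::topological_space \<Rightarrow> real"
  assumes "prob_space M" "sets M = sets borel" "f \<in> borel_measurable borel"
    and "\<And>x. l \<le> f x" "\<And>x. f x \<le> u"
  shows "l \<le> (\<integral>x. f x \<partial>M)" "(\<integral>x. f x \<partial>M) \<le> u"
proof -
  interpret prob_space M by fact
  have "\<bar>f x\<bar> \<le> max \<bar>l\<bar> \<bar>u\<bar>" for x using assms(4,5)[of x] by linarith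
  then have i: "integrable M f" by (rule integrable_bounded_borel[OF assms(1-3)])
  show "l \<le> (\<integral>x. f x \<partial>M)" using integral_mono[of M "\<lambda>_. l" f] i assms(4) by (simp add: prob_space)
  show "(\<integral>x. f x \<partial>M) \<le> u" using integral_mono[of M f "\<lambda>_. u"] i assms(5) by (simp add: prob_space)
qed

text \<open>Non-negativity of the variance.\<close>

lemma power2_integral_le:
  fixes f :: "'a::topological_space \<Rightarrow> real"
  assumes "prob_space M" "sets M = sets borel" "f \<in> borel_measurable borel" "\<And>x. \<bar>f x\<bar> \<le> K"
  shows "(\<integral>x. f x \<partial>M)\<^sup>2 \<le> (\<integral>x. (f x)\<^sup>2 \<partial>M)"
proof -
  interpret prob_space M by fact
  let ?a = "\<integral>x. f x \<partial>M"
  have i1: "integrable M f" by (rule integrable_bounded_borel[OF assms])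
  have i2: "integrable M (\<lambda>x. (f x)\<^sup>2)"
  proof (rule integrable_bounded_borel[OF assms(1,2), of _ "K\<^sup>2"])
    show "\<bar>(f x)\<^sup>2\<bar> \<le> K\<^sup>2" for x using power_mono[OF assms(4)[of x] abs_ge_zero, of 2] by simp
  qed (use assms(3) in simp)
  have "0 \<le> (\<integral>x. (f x - ?a)\<^sup>2 \<partial>M)" by simp
  also have "(\<integral>x. (f x - ?a)\<^sup>2 \<partial>M) = (\<integral>x. (f x)\<^sup>2 - 2 * ?a * f x + ?a\<^sup>2 \<partial>M)"
    by (rule Bochner_Integration.integral_cong) (simp_all add: power2_diff)
  also have "\<dots> = (\<integral>x. (f x)\<^sup>2 \<partial>M) - ?a\<^sup>2"
    using i1 i2 by (simp add: prob_space power2_eq_square)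
  finally show ?thesis by simp
qed

section \<open>Iterated integrals and integrals against mixtures\<close>

lemma iterated_integral_measurable:
  fixes f :: "'a::second_countable_topology \<Rightarrow> 'a \<Rightarrow> real"
  assumes "prob_space M" "sets M = sets borel"
    and f: "(\<lambda>(x, y). f x y) \<in> borel_measurable (borel \<Otimes>\<^sub>M borel)"
  shows "(\<lambda>x. \<integral>y. f x y \<partial>M) \<in> borel_measurable borel"
proof -
  interpret prob_space M by fact
  have "sets ((borel :: 'a measure) \<Otimes>\<^sub>M M) = sets (borel \<Otimes>\<^sub>M (borel :: 'a measure))"
    using assms(2) by (intro sets_pair_measure_cong) auto
  then have "(\<lambda>(x, y). f x y) \<in> borel_measurable ((borel :: 'a measure) \<Otimes>\<^sub>M M)"
    using f measurable_cong_sets[OF _ refl, of _ _ "borel :: real measure"] by blast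
  then show ?thesis by (rule borel_measurable_lebesgue_integral)
qed

lemma section_measurable:
  fixes f :: "'a::second_countable_topology \<Rightarrow> 'a \<Rightarrow> real"
  assumes f: "(\<lambda>(x, y). f x y) \<in> borel_measurable (borel \<Otimes>\<^sub>M borel)"
  shows "f x \<in> borel_measurable borel"
  using measurable_compose[OF measurable_Pair1'[of x borel borel] f] by simp

text \<open>The mixture identity is given on sets only; scaling, sums and monotone limits carry it
  to non-negative functions.\<close>

lemma nn_integral_mixture:
  fixes P :: "'a::topological_space measure"
  assumes fin: "finite I" and w: "\<And>i. i \<in> I \<Longrightarrow> 0 \<le> w i"
    and Pc: "\<And>i. i \<in> I \<Longrightarrow> prob_space (Pc i) \<and> sets (Pc i) = sets borel"
    and P: "prob_space P" "sets P = sets borel"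
    and mix: "\<forall>A\<in>sets borel. measure P A = (\<Sum>i\<in>I. w i * measure (Pc i) A)"
    and f: "f \<in> borel_measurable borel"
  shows "(\<integral>\<^sup>+x. f x \<partial>P) = (\<Sum>i\<in>I. ennreal (w i) * (\<integral>\<^sup>+x. f x \<partial>Pc i))"
  using f
proof (induction rule: borel_measurable_induct)
  case (cong f g)
  then have "f = g" by auto
  then show ?case using cong by simp
next
  case (set A)
  have "(\<integral>\<^sup>+x. indicator A x \<partial>Pc i) = ennreal (measure (Pc i) A)" if "i \<in> I" for i
  proof -
    interpret prob_space "Pc i" using Pc[OF that] by simp
    show ?thesis using Pc[OF that] set by (simp add: emeasure_eq_measure)
  qed
  then have "(\<Sum>i\<in>I. ennreal (w i) * (\<integral>\<^sup>+x. indicator A x \<partial>Pc i))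
      = (\<Sum>i\<in>I. ennreal (w i * measure (Pc i) A))"
    using w by (intro sum.cong) (auto simp: ennreal_mult)
  also have "\<dots> = ennreal (\<Sum>i\<in>I. w i * measure (Pc i) A)"
    using w by (intro sum_ennreal) auto
  also have "\<dots> = ennreal (measure P A)" using mix set by simp
  also have "\<dots> = (\<integral>\<^sup>+x. indicator A x \<partial>P)"
  proof -
    interpret prob_space P by fact
    show ?thesis using P(2) set by (simp add: emeasure_eq_measure)
  qed
  finally show ?case by simp
next
  case (mult u c)
  have m: "u \<in> borel_measurable P" "\<And>i. i \<in> I \<Longrightarrow> u \<in> borel_measurable (Pc i)"
    using mult Pc P by (auto cong: measurable_cong_sets)
  then show ?case using mult by (simp add: nn_integral_cmult sum_distrib_left mult_ac)
next
  case (add u v)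
  have m: "u \<in> borel_measurable P" "\<And>i. i \<in> I \<Longrightarrow> u \<in> borel_measurable (Pc i)"
    "v \<in> borel_measurable P" "\<And>i. i \<in> I \<Longrightarrow> v \<in> borel_measurable (Pc i)"
    using add Pc P by (auto cong: measurable_cong_sets)
  then show ?case using add by (simp add: nn_integral_add distrib_left sum.distrib)
next
  case (seq U)
  have m: "U n \<in> borel_measurable P" "\<And>i. i \<in> I \<Longrightarrow> U n \<in> borel_measurable (Pc i)" for n
    using seq Pc P by (auto cong: measurable_cong_sets)
  have S: "(\<integral>\<^sup>+x. (SUP n. U n) x \<partial>N) = (SUP n. \<integral>\<^sup>+x. U n x \<partial>N)"
    if "\<And>n. U n \<in> borel_measurable N" for N
    using nn_integral_monotone_convergence_SUP[of U N] seq that by (simp add: image_comp)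
  have "(\<integral>\<^sup>+x. (SUP n. U n) x \<partial>P) = (SUP n. \<Sum>i\<in>I. ennreal (w i) * (\<integral>\<^sup>+x. U n x \<partial>Pc i))"
    using S[of P] m(1) seq by simp
  also have "\<dots> = (\<Sum>i\<in>I. SUP n. ennreal (w i) * (\<integral>\<^sup>+x. U n x \<partial>Pc i))"
  proof (rule ennreal_SUP_sum)
    fix i
    show "incseq (\<lambda>n. ennreal (w i) * (\<integral>\<^sup>+x. U n x \<partial>Pc i))"
      using \<open>incseq U\<close> by (auto simp: incseq_def le_fun_def intro!: mult_left_mono nn_integral_mono)
  qed
  also have "\<dots> = (\<Sum>i\<in>I. ennreal (w i) * (\<integral>\<^sup>+x. (SUP n. U n) x \<partial>Pc i))"
    by (intro sum.cong refl) (simp only: S[OF m(2)] SUP_mult_left_ennreal)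
  finally show ?case .
qed

lemma integral_mixture:
  fixes P :: "'a::topological_space measure"
  assumes fin: "finite I" and w: "\<And>i. i \<in> I \<Longrightarrow> 0 \<le> w i"
    and Pc: "\<And>i. i \<in> I \<Longrightarrow> prob_space (Pc i) \<and> sets (Pc i) = sets borel"
    and P: "prob_space P" "sets P = sets borel"
    and mix: "\<forall>A\<in>sets borel. measure P A = (\<Sum>i\<in>I. w i * measure (Pc i) A)"
    and f: "f \<in> borel_measurable borel" "\<And>x. 0 \<le> f x" "\<And>x. f x \<le> K"
  shows "(\<integral>x. f x \<partial>P) = (\<Sum>i\<in>I. w i * (\<integral>x. f x \<partial>Pc i))"
proof -
  have eq: "(\<integral>\<^sup>+x. ennreal (f x) \<partial>N) = ennreal (\<integral>x. f x \<partial>N)"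
    if "prob_space N" "sets N = sets borel" for N
  proof (rule nn_integral_eq_integral)
    show "integrable N f"
      using f(2,3) by (intro integrable_bounded_borel[OF that f(1), of K]) (auto simp: abs_of_nonneg)
  qed (use f in simp)
  have n: "0 \<le> (\<integral>x. f x \<partial>Pc i)" for i using f(2) by simp
  have "ennreal (\<integral>x. f x \<partial>P) = (\<Sum>i\<in>I. ennreal (w i) * (\<integral>\<^sup>+x. ennreal (f x) \<partial>Pc i))"
    using nn_integral_mixture[OF fin w Pc P mix, of "\<lambda>x. ennreal (f x)"] f(1) by (simp add: eq[OF P])
  also have "\<dots> = (\<Sum>i\<in>I. ennreal (w i * (\<integral>x. f x \<partial>Pc i)))"
    using w n Pc by (intro sum.cong) (auto simp: eq ennreal_mult)
  also have "\<dots> = ennreal (\<Sum>i\<in>I. w i * (\<integral>x. f x \<partial>Pc i))"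
    using w n by (intro sum_ennreal) auto
  finally show ?thesis
    using w n f(2) by (subst (asm) ennreal_inj) (auto intro!: sum_nonneg)
qed

text \<open>The variance bound is an extended integral and so carries finiteness; integrability is
  extracted from it here.\<close>

lemma integral_norm_power2_le:
  fixes a :: "'a::real_normed_vector"
  assumes "sets M = sets borel"
    and "(\<integral>\<^sup>+x. ennreal ((norm (x - a))\<^sup>2) \<partial>M) \<le> ennreal (v\<^sup>2)"
  shows "integrable M (\<lambda>x. (norm (x - a))\<^sup>2)" "(\<integral>x. (norm (x - a))\<^sup>2 \<partial>M) \<le> v\<^sup>2"
proof -
  have "(\<lambda>x. (norm (x - a))\<^sup>2) \<in> borel_measurable borel"
    by (intro borel_measurable_continuous_onI continuous_intros)
  then have m: "(\<lambda>x. (norm (x - a))\<^sup>2) \<in> borel_measurable M"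
    using assms(1) by (simp cong: measurable_cong_sets)
  show i: "integrable M (\<lambda>x. (norm (x - a))\<^sup>2)"
    using assms(2) by (intro integrableI_bounded m) (auto intro: le_less_trans)
  show "(\<integral>x. (norm (x - a))\<^sup>2 \<partial>M) \<le> v\<^sup>2"
    using assms(2) nn_integral_eq_integral[OF i] by simp
qed

lemma integrable_iterated_integral:
  fixes f :: "'a::second_countable_topology \<Rightarrow> 'a \<Rightarrow> real"
  assumes M: "prob_space M" "sets M = sets borel" and N: "prob_space N" "sets N = sets borel"
    and f: "(\<lambda>(x, y). f x y) \<in> borel_measurable (borel \<Otimes>\<^sub>M borel)"
    and fb: "\<And>x y. 0 \<le> f x y" "\<And>x y. f x y \<le> 1"
  shows "integrable N (f x)" "integrable M (\<lambda>x. \<integral>y. f x y \<partial>N)"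
    "0 \<le> (\<integral>y. f x y \<partial>N)" "(\<integral>y. f x y \<partial>N) \<le> 1"
proof -
  have b: "0 \<le> (\<integral>y. f x y \<partial>N)" "(\<integral>y. f x y \<partial>N) \<le> 1" for x
    using integral_bounds[OF N section_measurable[OF f], of 0 x 1] fb by auto
  then show "0 \<le> (\<integral>y. f x y \<partial>N)" "(\<integral>y. f x y \<partial>N) \<le> 1" .
  show "integrable N (f x)"
    using fb by (intro integrable_bounded_borel[OF N, of _ 1] section_measurable[OF f])
      (auto simp: abs_of_nonneg)
  show "integrable M (\<lambda>x. \<integral>y. f x y \<partial>N)"
    using b by (intro integrable_bounded_borel[OF M, of _ 1] iterated_integral_measurable[OF N f])
      (auto simp: abs_of_nonneg)
qed

text \<open>Turns a pointwise estimate into one for independent draws from \<open>M\<close> and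
  \<open>N\<close>; only the second moments about the centres \<open>a\<close> and \<open>b\<close>
  enter.\<close>

lemma iterated_integral_le:
  fixes f :: "'a::{real_normed_vector, second_countable_topology} \<Rightarrow> 'a \<Rightarrow> real"
  assumes M: "prob_space M" "sets M = sets borel" and N: "prob_space N" "sets N = sets borel"
    and f: "(\<lambda>(x, y). f x y) \<in> borel_measurable (borel \<Otimes>\<^sub>M borel)"
    and fb: "\<And>x y. 0 \<le> f x y" "\<And>x y. f x y \<le> 1"
    and vM: "(\<integral>\<^sup>+x. ennreal ((norm (x - a))\<^sup>2) \<partial>M) \<le> ennreal (u\<^sup>2)"
    and vN: "(\<integral>\<^sup>+x. ennreal ((norm (x - b))\<^sup>2) \<partial>N) \<le> ennreal (v\<^sup>2)"
    and le: "\<And>x y. f x y \<le> c + p * ((norm (x - a))\<^sup>2 + (norm (y - b))\<^sup>2)" and p: "0 \<le> p"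
  shows "(\<integral>x. \<integral>y. f x y \<partial>N \<partial>M) \<le> c + p * (u\<^sup>2 + v\<^sup>2)"
proof -
  interpret M: prob_space M by fact
  interpret N: prob_space N by fact
  note iM = integral_norm_power2_le[OF M(2) vM] and iN = integral_norm_power2_le[OF N(2) vN]
  have "(\<integral>y. f x y \<partial>N) \<le> c + p * (norm (x - a))\<^sup>2 + p * v\<^sup>2" for x
  proof -
    have "integrable N (f x)" by (rule integrable_iterated_integral(1)[OF M N f fb])
    then have "(\<integral>y. f x y \<partial>N) \<le> (\<integral>y. (c + p * (norm (x - a))\<^sup>2) + p * (norm (y - b))\<^sup>2 \<partial>N)"
      using iN le[of x] by (intro integral_mono) (auto simp: algebra_simps)
    also have "\<dots> = c + p * (norm (x - a))\<^sup>2 + p * (\<integral>y. (norm (y - b))\<^sup>2 \<partial>N)"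
      using iN(1) by (simp add: N.prob_space)
    also have "\<dots> \<le> c + p * (norm (x - a))\<^sup>2 + p * v\<^sup>2"
      using iN(2) p by (simp add: mult_left_mono)
    finally show ?thesis .
  qed
  moreover have "integrable M (\<lambda>x. \<integral>y. f x y \<partial>N)"
    by (rule integrable_iterated_integral(2)[OF M N f fb])
  ultimately have "(\<integral>x. \<integral>y. f x y \<partial>N \<partial>M) \<le> (\<integral>x. (c + p * v\<^sup>2) + p * (norm (x - a))\<^sup>2 \<partial>M)"
    using iM by (intro integral_mono) (auto simp: algebra_simps)
  also have "\<dots> = c + p * v\<^sup>2 + p * (\<integral>x. (norm (x - a))\<^sup>2 \<partial>M)"
    using iM(1) by (simp add: M.prob_space)
  also have "\<dots> \<le> c + p * v\<^sup>2 + p * u\<^sup>2" using iM(2) p by (simp add: mult_left_mono)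
  finally show ?thesis by (simp add: algebra_simps)
qed

section \<open>Pointwise estimates for the Gaussian kernel\<close>

lemma gauss_kernel_bounds:
  "0 < gauss_kernel s x y" "gauss_kernel s x y \<le> 1"
  by (simp_all add: gauss_kernel_def)

lemma gauss_kernel_measurable:
  "(\<lambda>(x, y :: 'a::{real_normed_vector, second_countable_topology}). gauss_kernel s x y)
    \<in> borel_measurable (borel \<Otimes>\<^sub>M borel)"
  unfolding gauss_kernel_def by measurable

lemma gauss_kernel_power2_measurable:
  "(\<lambda>(x, y :: 'a::{real_normed_vector, second_countable_topology}). (gauss_kernel s x y)\<^sup>2)
    \<in> borel_measurable (borel \<Otimes>\<^sub>M borel)"
  using borel_measurable_power[OF gauss_kernel_measurable, of s 2] by (simp add: case_prod_beta')

lemma gauss_kernel_power2_bounds: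
  "0 \<le> (gauss_kernel s x y)\<^sup>2" "(gauss_kernel s x y)\<^sup>2 \<le> 1"
  using gauss_kernel_bounds[of s x y] by (auto simp: power_le_one)

lemma norm_diff_power2_le:
  fixes x y :: "'a::real_normed_vector"
  shows "(norm (x - y))\<^sup>2 \<le> 2 * ((norm x)\<^sup>2 + (norm y)\<^sup>2)"
proof -
  have "(norm (x - y))\<^sup>2 \<le> (norm x + norm y)\<^sup>2"
    by (intro power_mono norm_triangle_ineq4) simp
  also have "\<dots> \<le> 2 * ((norm x)\<^sup>2 + (norm y)\<^sup>2)"
    using zero_le_power2[of "norm x - norm y"] unfolding power2_sum power2_diff by simp
  finally show ?thesis .
qed

text \<open>Uses \<open>1 - exp (- z) \<le> z\<close>, with the distance split at the common centre
  \<open>a\<close>.\<close>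

lemma one_minus_gauss_kernel_le:
  assumes s: "0 < s"
  shows "1 - gauss_kernel s x y \<le> (1 / s\<^sup>2) * ((norm (x - a))\<^sup>2 + (norm (y - a))\<^sup>2)"
proof -
  have "1 - gauss_kernel s x y \<le> (norm (x - y))\<^sup>2 / (2 * s\<^sup>2)"
    using exp_ge_add_one_self[of "- ((norm (x - y))\<^sup>2) / (2 * s\<^sup>2)"] by (simp add: gauss_kernel_def)
  also have "\<dots> \<le> (2 * ((norm (x - a))\<^sup>2 + (norm (y - a))\<^sup>2)) / (2 * s\<^sup>2)"
    using norm_diff_power2_le[of "x - a" "y - a"] by (intro divide_right_mono) auto
  also have "(2 * X) / (2 * s\<^sup>2) = (1 / s\<^sup>2) * X" for X by simp
  finally show ?thesis .
qed

text \<open>The half-width Gaussian \<open>exp (- r\<^sup>2 / 2)\<close> is Lipschitz with constant \<open>1 / sqrt 2\<close>; squaring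
  gives the comparison.\<close>

lemma exp_neg_power2_compare:
  fixes a b :: real
  shows "exp (- a\<^sup>2) \<le> 2 * exp (- b\<^sup>2) + (a - b)\<^sup>2"
proof -
  define h where "h u = exp (- u\<^sup>2 / 2)" for u :: real
  have der: "(h has_real_derivative (- u * h u)) (at u)" for u
    unfolding h_def by (auto intro!: derivative_eq_intros)
  \<comment> \<open>With \<open>z = u\<^sup>2\<close>, the Taylor bound gives
    \<open>exp z \<ge> 1 + z + z\<^sup>2 / 2 \<ge> 2 * z\<close>.\<close>
  have bd: "(u * h u)\<^sup>2 \<le> 1 / 2" for u
  proof -
    have "2 * u\<^sup>2 \<le> exp (u\<^sup>2)"
      using exp_lower_Taylor_quadratic[of "u\<^sup>2"] zero_le_power2[of "u\<^sup>2 - 1"]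
      by (simp add: power2_diff)
    moreover have "(h u)\<^sup>2 = exp (- u\<^sup>2)" by (simp add: h_def flip: exp_double)
    then have "(u * h u)\<^sup>2 = u\<^sup>2 / exp (u\<^sup>2)"
      by (simp add: power_mult_distrib exp_minus divide_inverse)
    ultimately show ?thesis by (simp add: divide_le_eq)
  qed
  have mvt: "(h x - h y)\<^sup>2 \<le> (x - y)\<^sup>2 / 2" if "x < y" for x y
  proof -
    have "\<exists>z>x. z < y \<and> h y - h x = (y - x) * (- z * h z)" by (rule MVT2[OF that]) (rule der)
    then obtain z where "h y - h x = (y - x) * (- z * h z)" by blast
    then have "(h x - h y)\<^sup>2 = (x - y)\<^sup>2 * (z * h z)\<^sup>2"
      by (simp add: power2_commute[of "h x"] power2_commute[of x] power_mult_distrib)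
    then show ?thesis using mult_left_mono[OF bd[of z] zero_le_power2[of "x - y"]] by simp
  qed
  have "(h a - h b)\<^sup>2 \<le> (a - b)\<^sup>2 / 2"
    using mvt[of a b] mvt[of b a] by (cases a b rule: linorder_cases) (auto simp: power2_commute)
  \<comment> \<open>The difference of the two sides is \<open>(h a - 2 * h b)\<^sup>2\<close>; the
    factor 2 before the last term absorbs the 1/2 of the Lipschitz estimate.\<close>
  moreover have "(h a)\<^sup>2 \<le> 2 * (h b)\<^sup>2 + 2 * (h a - h b)\<^sup>2"
    using zero_le_power2[of "h a - 2 * h b"] by (simp add: power2_eq_square algebra_simps)
  moreover have "(h u)\<^sup>2 = exp (- u\<^sup>2)" for u by (simp add: h_def flip: exp_double)
  ultimately show ?thesis by simp
qed

text \<open>Squaring the kernel doubles its exponent, which gives the shape of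
  \<open>exp_neg_power2_compare\<close> with distances divided by \<open>s\<close>. The two
  distances differ by at most the norm of \<open>(x - a) - (y - b)\<close>.\<close>

lemma gauss_kernel_power2_le:
  assumes s: "0 < s"
  shows "(gauss_kernel s x y)\<^sup>2 \<le> 2 * exp (- ((norm (a - b))\<^sup>2) / s\<^sup>2)
    + (2 / s\<^sup>2) * ((norm (x - a))\<^sup>2 + (norm (y - b))\<^sup>2)"
proof -
  have "(gauss_kernel s x y)\<^sup>2 = exp (- (norm (x - y) / s)\<^sup>2)"
    by (simp add: gauss_kernel_def power_divide flip: exp_double)
  also have "\<dots> \<le> 2 * exp (- (norm (a - b) / s)\<^sup>2) + (norm (x - y) / s - norm (a - b) / s)\<^sup>2"
    by (rule exp_neg_power2_compare)
  also have "(norm (x - y) / s - norm (a - b) / s)\<^sup>2 = (norm (x - y) - norm (a - b))\<^sup>2 / s\<^sup>2"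
    by (simp add: diff_divide_distrib[symmetric] power_divide)
  also have "\<dots> \<le> (norm ((x - a) - (y - b)))\<^sup>2 / s\<^sup>2"
  proof (intro divide_right_mono)
    have "\<bar>norm (x - y) - norm (a - b)\<bar> \<le> norm ((x - y) - (a - b))" by (rule norm_triangle_ineq3)
    then show "(norm (x - y) - norm (a - b))\<^sup>2 \<le> (norm ((x - a) - (y - b)))\<^sup>2"
      by (simp add: abs_le_square_iff[symmetric] algebra_simps)
  qed simp
  also have "\<dots> \<le> (2 * ((norm (x - a))\<^sup>2 + (norm (y - b))\<^sup>2)) / s\<^sup>2"
    by (intro divide_right_mono norm_diff_power2_le) simp
  finally show ?thesis by (simp add: power_divide)
qed

text \<open>The left side is the mean of \<open>(1 - ?k x y)\<^sup>2\<close>, which is at most that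
  of \<open>1 - ?k x y\<close> because the kernel lies between 0 and 1.\<close>

lemma gauss_kernel_diagonal_defect:
  fixes a :: "'a::{real_normed_vector, second_countable_topology}"
  assumes s: "0 < s" and M: "prob_space M" "sets M = sets borel"
    and v: "(\<integral>\<^sup>+x. ennreal ((norm (x - a))\<^sup>2) \<partial>M) \<le> ennreal (u\<^sup>2)"
  shows "(\<integral>x. \<integral>y. (gauss_kernel s x y)\<^sup>2 \<partial>M \<partial>M)
    - 2 * (\<integral>x. \<integral>y. gauss_kernel s x y \<partial>M \<partial>M) + 1 \<le> 2 * (u\<^sup>2 / s\<^sup>2)"
proof -
  interpret prob_space M by fact
  let ?k = "gauss_kernel s :: 'a \<Rightarrow> 'a \<Rightarrow> real"
  let ?f = "\<lambda>x y. (1 - ?k x y)\<^sup>2"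
  have fm: "(\<lambda>(x, y). ?f x y) \<in> borel_measurable (borel \<Otimes>\<^sub>M borel)"
    unfolding gauss_kernel_def by measurable
  have le: "?f x y \<le> 1 - ?k x y" for x y
    using gauss_kernel_bounds[of s x y] by (simp add: power2_eq_square mult_left_le)
  have f1: "?f x y \<le> 1" for x y
    using le[of x y] gauss_kernel_bounds(1)[of s x y] by simp
  note k1 = integrable_iterated_integral(1,2)[OF M M gauss_kernel_measurable
      less_imp_le[OF gauss_kernel_bounds(1)] gauss_kernel_bounds(2)]
  note k2 = integrable_iterated_integral(1,2)[OF M M gauss_kernel_power2_measurable
      gauss_kernel_power2_bounds]
  have "(\<integral>y. ?f x y \<partial>M) = 1 - 2 * (\<integral>y. ?k x y \<partial>M) + (\<integral>y. (?k x y)\<^sup>2 \<partial>M)" for x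
    using k1(1) k2(1) by (simp add: power2_diff prob_space)
  then have "(\<integral>x. \<integral>y. ?f x y \<partial>M \<partial>M)
      = 1 - 2 * (\<integral>x. \<integral>y. ?k x y \<partial>M \<partial>M) + (\<integral>x. \<integral>y. (?k x y)\<^sup>2 \<partial>M \<partial>M)"
    using k1(2) k2(2) by (simp add: prob_space)
  moreover have "(\<integral>x. \<integral>y. ?f x y \<partial>M \<partial>M) \<le> 0 + (1 / s\<^sup>2) * (u\<^sup>2 + u\<^sup>2)"
  proof (rule iterated_integral_le[OF M M fm _ f1 v v])
    show "?f x y \<le> 0 + (1 / s\<^sup>2) * ((norm (x - a))\<^sup>2 + (norm (y - a))\<^sup>2)" for x y
      using order_trans[OF le one_minus_gauss_kernel_le[OF s]] by simp
  qed simp_all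
  ultimately show ?thesis by simp
qed

subsection \<open>Gaussian feature maps\<close>

locale gaussian_feature_map =
  fixes s :: real
    and phi :: "'a::{real_normed_vector, second_countable_topology} \<Rightarrow> 'h::{real_inner, complete_space}"
  assumes feature: "inner (phi x) (phi y) = gauss_kernel s x y"
begin

lemma norm_feature: "norm (phi x) = 1"
  by (simp add: norm_eq_1 feature gauss_kernel_def)

text \<open>The squared distance of two features is \<open>2 - 2 * gauss_kernel s x a\<close>, so
  continuity is inherited from the kernel. All measurability of \<open>phi\<close> stems from
  here.\<close>

lemma feature_continuous: "continuous_on UNIV phi"
proof -
  have "(phi \<longlongrightarrow> phi a) (at a)" for a
  proof -
    have sq: "(norm (phi x - phi a))\<^sup>2 = 2 - 2 * gauss_kernel s x a" for x
      using norm_feature[of x] norm_feature[of a]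
      by (simp add: power2_norm_eq_inner inner_diff_left inner_diff_right norm_eq_1
          inner_commute[of "phi a" "phi x"] feature[of x a])
    \<comment> \<open>A product with the reciprocal, since the limit rule for quotients asks for a
      nonzero denominator and \<open>s\<close> is arbitrary here.\<close>
    have "((\<lambda>x. exp (- ((norm (x - a))\<^sup>2) * (1 / (2 * s\<^sup>2)))) \<longlongrightarrow>
        exp (- ((norm (a - a))\<^sup>2) * (1 / (2 * s\<^sup>2)))) (at a)"
      by (intro tendsto_intros)
    moreover have "exp (- ((norm (x - a))\<^sup>2) * (1 / (2 * s\<^sup>2))) = gauss_kernel s x a" for x
      by (simp add: gauss_kernel_def)
    moreover have "gauss_kernel s a a = 1" by (simp add: gauss_kernel_def)
    ultimately have "((\<lambda>x. gauss_kernel s x a) \<longlongrightarrow> 1) (at a)" by (simp only:)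
    then have "((\<lambda>x. 2 - 2 * gauss_kernel s x a) \<longlongrightarrow> 2 - 2 * 1) (at a)"
      by (intro tendsto_intros)
    then have "((\<lambda>x. (norm (phi x - phi a))\<^sup>2) \<longlongrightarrow> 0) (at a)" unfolding sq by simp
    then have "((\<lambda>x. norm (phi x - phi a)) \<longlongrightarrow> 0) (at a)"
      by (subst (asm) power_tendsto_0_iff) simp_all
    then have "((\<lambda>x. phi x - phi a) \<longlongrightarrow> 0) (at a)" by (rule tendsto_norm_zero_cancel)
    then show ?thesis by (rule Lim_null[THEN iffD2])
  qed
  then show ?thesis by (simp add: continuous_on_def)
qed

lemma feature_inner_measurable [measurable]: "(\<lambda>x. inner (phi x) h) \<in> borel_measurable borel"
  by (intro borel_measurable_continuous_onI continuous_intros feature_continuous)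

lemma feature_inner_bound: "\<bar>inner (phi x) h\<bar> \<le> norm h"
  using Cauchy_Schwarz_ineq2[of "phi x" h] by (simp add: norm_feature)

lemma feature_inner_power2_bound: "(inner (phi x) h)\<^sup>2 \<le> (norm h)\<^sup>2"
  using power_mono[OF feature_inner_bound abs_ge_zero, of x h 2] by simp

lemma feature_inner_integrable:
  assumes "prob_space M" "sets M = sets borel"
  shows "integrable M (\<lambda>x. inner (phi x) h)"
    "integrable M (\<lambda>x. inner (phi x) h * inner (phi x) g)"
proof -
  show "integrable M (\<lambda>x. inner (phi x) h)"
    by (rule integrable_bounded_borel[OF assms]) (rule feature_inner_measurable feature_inner_bound)+
  show "integrable M (\<lambda>x. inner (phi x) h * inner (phi x) g)"
  proof (rule integrable_bounded_borel[OF assms])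
    show "\<bar>inner (phi x) h * inner (phi x) g\<bar> \<le> norm h * norm g" for x
      unfolding abs_mult by (intro mult_mono feature_inner_bound) auto
  qed simp
qed

text \<open>The expectation of \<open>phi\<close> in weak form: features are unit vectors, so the
  functional is bounded by \<open>norm h\<close> and Riesz applies.\<close>

lemma mean_embedding_exists:
  assumes M: "prob_space M" "sets M = sets borel"
  shows "\<exists>m. \<forall>h. inner m h = (\<integral>x. inner (phi x) h \<partial>M)"
proof -
  interpret M: prob_space M by fact
  note int = feature_inner_integrable[OF M]
  have "\<exists>m. \<forall>h. (\<integral>x. inner (phi x) h \<partial>M) = inner m h"
  proof (rule riesz_representation)
    show "linear (\<lambda>h. \<integral>x. inner (phi x) h \<partial>M)"
      using int(1) by (intro linearI) (simp_all add: inner_add_right)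
    have "(\<integral>x. inner (phi x) h \<partial>M) \<le> norm h" "- norm h \<le> (\<integral>x. inner (phi x) h \<partial>M)" for h
      using feature_inner_bound[of _ h]
      by (auto intro!: integral_bounds[OF M] simp: abs_le_iff minus_le_iff)
    then show "\<bar>\<integral>x. inner (phi x) h \<partial>M\<bar> \<le> 1 * norm h" for h
      by (simp add: abs_le_iff minus_le_iff)
  qed
  then show ?thesis by metis
qed

text \<open>The defining identity of \<open>m\<close> is used twice, at \<open>m\<close> and at
  \<open>phi x\<close>.\<close>

lemma norm_mean_embedding:
  assumes m: "\<forall>h. inner m h = (\<integral>x. inner (phi x) h \<partial>M)"
  shows "(norm m)\<^sup>2 = (\<integral>x. \<integral>y. gauss_kernel s x y \<partial>M \<partial>M)"
proof -
  have "(norm m)\<^sup>2 = (\<integral>x. inner m (phi x) \<partial>M)"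
    using m by (simp add: power2_norm_eq_inner inner_commute)
  also have "\<dots> = (\<integral>x. \<integral>y. inner (phi y) (phi x) \<partial>M \<partial>M)" using m by simp
  also have "\<dots> = (\<integral>x. \<integral>y. gauss_kernel s x y \<partial>M \<partial>M)"
    by (simp add: inner_commute[of "phi _" "phi _"] feature gauss_kernel_def norm_minus_commute)
  finally show ?thesis .
qed

text \<open>The trace over \<open>F\<close> is the mean of the Bessel sums of the unit vectors
  \<open>phi x\<close>, hence at most 1.\<close>

lemma kernel_cov_op_trace_bounded:
  assumes P: "prob_space P" "sets P = sets borel" and cov: "is_kernel_cov_op P phi C"
  shows "trace_bounded_form C 1"
proof (rule trace_bounded_form.intro)
  note int = feature_inner_integrable[OF P]
  have C: "inner (C h) g = (\<integral>x. inner (phi x) h * inner (phi x) g \<partial>P)" for h g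
    using cov by (simp add: is_kernel_cov_op_def)
  show "linear C"
  proof (rule linearI)
    fix h g :: 'h and r :: real
    have "inner (C (h + g)) z = inner (C h + C g) z" for z
      using int(2) by (simp add: C inner_add_left inner_add_right distrib_right)
    then show "C (h + g) = C h + C g" using vector_eq_rdot by blast
    have "inner (C (r *\<^sub>R h)) z = inner (r *\<^sub>R C h) z" for z
      by (simp add: C mult.assoc)
    then show "C (r *\<^sub>R h) = r *\<^sub>R C h" using vector_eq_rdot by blast
  qed
  show "inner (C h) g = inner h (C g)" for h g
    by (subst inner_commute[of h]) (simp add: C mult.commute)
  show "0 \<le> inner (C h) h" for h by (simp add: C)
  show "(\<Sum>v\<in>F. inner (C v) v) \<le> 1" if "orthonormal_family F" for F
  proof -
    have "(\<Sum>v\<in>F. inner (C v) v) = (\<integral>x. (\<Sum>v\<in>F. (inner (phi x) v)\<^sup>2) \<partial>P)"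
      unfolding C power2_eq_square by (rule Bochner_Integration.integral_sum[symmetric]) (rule int(2))
    also have "\<dots> \<le> 1"
    proof (rule integral_bounds(2)[OF P])
      show "0 \<le> (\<Sum>v\<in>F. (inner (phi x) v)\<^sup>2)" for x by (simp add: sum_nonneg)
      show "(\<Sum>v\<in>F. (inner (phi x) v)\<^sup>2) \<le> 1" for x
        using bessel_inequality[OF that, of "phi x"] by (simp add: norm_feature)
    qed simp
    finally show ?thesis .
  qed
qed

text \<open>For an eigenfamily the squared eigenvalues sum to the mean of \<open>?g\<close>. By
  positivity on the residual, \<open>?g x\<close> is at most the form at \<open>phi x\<close>, which
  is the inner kernel integral.\<close>

lemma sum_power2_eigenvalue_le_integral:
  assumes P: "prob_space P" "sets P = sets borel" and cov: "is_kernel_cov_op P phi C"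
  shows "(\<Sum>i=1..k. (op_eigenvalue C i)\<^sup>2) \<le> (\<integral>x. \<integral>y. (gauss_kernel s x y)\<^sup>2 \<partial>P \<partial>P)"
proof -
  interpret trace_bounded_form C 1 by (rule kernel_cov_op_trace_bounded[OF assms])
  have C: "inner (C h) h = (\<integral>x. (inner (phi x) h)\<^sup>2 \<partial>P)" for h
    using cov by (simp add: is_kernel_cov_op_def power2_eq_square)
  have k2: "inner (C (phi x)) (phi x) = (\<integral>y. (gauss_kernel s x y)\<^sup>2 \<partial>P)" for x
    unfolding C feature by (simp add: gauss_kernel_def norm_minus_commute)
  show ?thesis
  proof (rule sum_power2_op_eigenvalue_le)
    fix t F assume F: "eigen_family t F"
    let ?g = "\<lambda>x. \<Sum>v\<in>F. inner (C v) v * (inner (phi x) v)\<^sup>2"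
    have le: "?g x \<le> (\<integral>y. (gauss_kernel s x y)\<^sup>2 \<partial>P)" for x
      using form_eigen_decomp[OF F, of "phi x"] pos[of "phi x - proj_on F (phi x)"] by (simp add: k2)
    have int: "integrable P (\<lambda>x. inner (C v) v * (inner (phi x) v)\<^sup>2)" for v
      using feature_inner_integrable(2)[OF P, of v v] by (simp add: power2_eq_square)
    have "(\<Sum>v\<in>F. (inner (C v) v)\<^sup>2) = (\<Sum>v\<in>F. \<integral>x. inner (C v) v * (inner (phi x) v)\<^sup>2 \<partial>P)"
      by (rule sum.cong) (simp_all add: C power2_eq_square)
    also have "\<dots> = (\<integral>x. ?g x \<partial>P)"
      by (rule Bochner_Integration.integral_sum[symmetric]) (rule int)
    also have "\<dots> \<le> (\<integral>x. \<integral>y. (gauss_kernel s x y)\<^sup>2 \<partial>P \<partial>P)"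
    proof (rule integral_mono)
      show "integrable P ?g" using int by (rule Bochner_Integration.integrable_sum)
      show "integrable P (\<lambda>x. \<integral>y. (gauss_kernel s x y)\<^sup>2 \<partial>P)"
        by (rule integrable_iterated_integral(2)[OF P P gauss_kernel_power2_measurable
              gauss_kernel_power2_bounds])
    qed (rule le)
    finally show "(\<Sum>v\<in>F. (inner (C v) v)\<^sup>2) \<le> (\<integral>x. \<integral>y. (gauss_kernel s x y)\<^sup>2 \<partial>P \<partial>P)" .
  qed
qed

end

subsection \<open>Mixtures\<close>

text \<open>Summation by parts: domination of all partial sums survives decreasing non-negative
  weights.\<close>

lemma abel_sum_mono:
  fixes w q l :: "nat \<Rightarrow> real"
  assumes w: "\<And>i. i \<in> {1..k} \<Longrightarrow> 0 \<le> w i"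
    and anti: "\<And>i j. 1 \<le> i \<Longrightarrow> i \<le> j \<Longrightarrow> j \<le> k \<Longrightarrow> w j \<le> w i"
    and part: "\<And>r. r \<le> k \<Longrightarrow> (\<Sum>i=1..r. q i) \<le> (\<Sum>i=1..r. l i)"
  shows "(\<Sum>i=1..k. w i * q i) \<le> (\<Sum>i=1..k. w i * l i)"
proof -
  define S where "S n = (\<Sum>i=1..n. l i - q i)" for n
  have S0: "0 \<le> S n" if "n \<le> k" for n using part[OF that] by (simp add: S_def sum_subtractf)
  \<comment> \<open>Induction invariant: the boundary term \<open>w n * S n\<close> is retained, and
    lowering its weight only decreases it because \<open>S n\<close> is non-negative.\<close>
  have "w n * S n \<le> (\<Sum>i=1..n. w i * (l i - q i))" if "1 \<le> n" "n \<le> k" for n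
    using that
  proof (induction n rule: nat_induct_at_least)
    case base
    then show ?case by (simp add: S_def)
  next
    case (Suc n)
    have "w (Suc n) * S n \<le> w n * S n" using anti[of n "Suc n"] S0[of n] Suc by (intro mult_right_mono) auto
    also have "\<dots> \<le> (\<Sum>i=1..n. w i * (l i - q i))" using Suc by simp
    finally show ?case by (simp add: S_def algebra_simps)
  qed
  from this[of k] have "0 \<le> (\<Sum>i=1..k. w i * (l i - q i))"
    using w[of k] S0[of k] by (cases "k = 0") (auto intro: order_trans[rotated])
  then show ?thesis by (simp add: right_diff_distrib sum_subtractf)
qed

text \<open>Induction on \<open>k\<close>: by symmetry the new row and the new column contribute
  equally.\<close>

lemma sum_off_diagonal_symmetric:
  fixes a :: "nat \<Rightarrow> nat \<Rightarrow> real"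
  assumes a: "\<And>i j. a i j = a j i"
  shows "(\<Sum>i=1..k. \<Sum>j=1..k. if i = j then 0 else a i j)
    = 2 * (\<Sum>i=2..k. \<Sum>j=1..i-1. a i j)"
proof (induction k)
  case (Suc k)
  let ?a = "\<lambda>i j. if i = j then 0 else a i j"
  have c1: "(\<Sum>i=1..k. ?a i (Suc k)) = (\<Sum>j=1..k. a (Suc k) j)"
    by (intro sum.cong) (auto simp: a[of "Suc k"])
  have c2: "(\<Sum>j=1..k. ?a (Suc k) j) = (\<Sum>j=1..k. a (Suc k) j)"
    by (intro sum.cong) auto
  have "(\<Sum>i=1..Suc k. \<Sum>j=1..Suc k. ?a i j)
    = (\<Sum>i=1..k. \<Sum>j=1..k. ?a i j) + (\<Sum>i=1..k. ?a i (Suc k)) + (\<Sum>j=1..k. ?a (Suc k) j)"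
    by (simp add: sum.distrib)
  also have "\<dots> = 2 * (\<Sum>i=2..k. \<Sum>j=1..i-1. a i j) + 2 * (\<Sum>j=1..k. a (Suc k) j)"
    unfolding c1 c2 Suc by simp
  also have "\<dots> = 2 * (\<Sum>i=2..Suc k. \<Sum>j=1..i-1. a i j)"
    by (cases "k = 0") simp_all
  finally show ?case .
qed simp

theorem theorem1:
  fixes k :: nat
    and w :: "nat \<Rightarrow> real"
    and Pc :: "nat \<Rightarrow> (real^'d) measure"
    and P :: "(real^'d) measure"
    and mu :: "nat \<Rightarrow> real^'d"
    and sig :: "nat \<Rightarrow> real"
    and s :: real
    and phi :: "real^'d \<Rightarrow> 'h::{real_inner, complete_space}"
    and C :: "'h \<Rightarrow> 'h"
  assumes w_nonneg: "\<forall>i\<in>{1..k}. 0 \<le> w i"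
    and w_sum: "(\<Sum>i=1..k. w i) = 1"
    and w_sorted: "\<forall>i\<in>{1..k}. \<forall>j\<in>{1..k}. i \<le> j \<longrightarrow> w j \<le> w i"
    and Pc_prob: "\<forall>i\<in>{1..k}. prob_space (Pc i) \<and> sets (Pc i) = sets borel"
    and P_prob: "prob_space P" and P_sets: "sets P = sets borel"
    and P_mix: "\<forall>A\<in>sets borel. measure P A = (\<Sum>i=1..k. w i * measure (Pc i) A)"
    and mean: "\<forall>i\<in>{1..k}. integrable (Pc i) (\<lambda>x. x) \<and> mu i = (\<integral>x. x \<partial>(Pc i))"
    and var: "\<forall>i\<in>{1..k}.
       (\<integral>\<^sup>+x. ennreal ((norm (x - mu i))^2) \<partial>(Pc i)) \<le> ennreal ((sig i)^2)"
    and s_pos: "0 < s"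
    and feature: "\<forall>x y. inner (phi x) (phi y) = gauss_kernel s x y"
    and cov: "is_kernel_cov_op P phi C"
  shows "(\<Sum>i=1..k. (op_eigenvalue C i - w i)^2)
     \<le> 4 * (\<Sum>i=1..k. w i * (sig i)^2 / s^2)
       + 16 * (\<Sum>i=2..k. \<Sum>j=1..i-1. w i * exp (- ((norm (mu i - mu j))^2) / s^2))"
proof -
  interpret gaussian_feature_map s phi by unfold_locales (rule feature[rule_format])
  interpret trace_bounded_form C 1 by (rule kernel_cov_op_trace_bounded[OF P_prob P_sets cov])
  define lam where "lam = op_eigenvalue C"
  \<comment> \<open>\<open>I i\<close> is the squared norm of the mean embedding of component
    \<open>i\<close>; \<open>J i j\<close> is the mean squared kernel between independent draws from
    components \<open>i\<close> and \<open>j\<close>.\<close>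
  define I where "I i = (\<integral>x. \<integral>y. gauss_kernel s x y \<partial>Pc i \<partial>Pc i)" for i
  define J where "J i j = (\<integral>x. \<integral>y. (gauss_kernel s x y)\<^sup>2 \<partial>Pc j \<partial>Pc i)" for i j
  define e where "e i j = exp (- ((norm (mu i - mu j))\<^sup>2) / s\<^sup>2)" for i j
  define v where "v i = (sig i)\<^sup>2 / s\<^sup>2" for i
  have w0: "0 \<le> w i" if "i \<in> {1..k}" for i using w_nonneg that by blast
  have w1: "w i \<le> 1" if "i \<in> {1..k}" for i
    using member_le_sum[OF that, of w] w0 w_sum by simp
  have Pi: "prob_space (Pc i) \<and> sets (Pc i) = sets borel" if "i \<in> {1..k}" for i
    using Pc_prob that by blast
  have Pi1: "prob_space (Pc i)" and Pi2: "sets (Pc i) = sets borel" if "i \<in> {1..k}" for i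
    using Pi[OF that] by auto
  have Pv: "(\<integral>\<^sup>+x. ennreal ((norm (x - mu i))\<^sup>2) \<partial>Pc i) \<le> ennreal ((sig i)\<^sup>2)"
    if "i \<in> {1..k}" for i using var that by blast
  have v0: "0 \<le> v i" for i by (simp add: v_def)
  note mixture = integral_mixture[OF finite_atLeastAtMost w0 Pi P_prob P_sets P_mix]
  let ?k2 = "\<lambda>x y :: real^'d. (gauss_kernel s x y)\<^sup>2"
  note k2m = gauss_kernel_power2_measurable
  \<comment> \<open>Hilbert-Schmidt bound, with both integrals against \<open>P\<close> expanded
    into components.\<close>
  have hs: "(\<Sum>i=1..k. (lam i)\<^sup>2) \<le> (\<Sum>i=1..k. \<Sum>j=1..k. w i * w j * J i j)"
  proof -
    have "(\<integral>x. \<integral>y. ?k2 x y \<partial>P \<partial>P) = (\<Sum>i=1..k. w i * (\<integral>x. \<integral>y. ?k2 x y \<partial>P \<partial>Pc i))"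
      by (rule mixture[OF _ _ iterated_integral_measurable[OF P_prob P_sets k2m]])
        (rule integrable_iterated_integral[OF P_prob P_sets P_prob P_sets k2m gauss_kernel_power2_bounds]
          | assumption)+
    also have "\<dots> = (\<Sum>i=1..k. w i * (\<Sum>j=1..k. w j * J i j))"
    proof (rule sum.cong[OF refl])
      fix i assume i: "i \<in> {1..k}"
      have "(\<integral>y. ?k2 x y \<partial>P) = (\<Sum>j=1..k. w j * (\<integral>y. ?k2 x y \<partial>Pc j))" for x
        by (rule mixture[OF _ _ section_measurable[OF k2m]])
          (rule gauss_kernel_power2_bounds | assumption)+
      then have "(\<integral>x. \<integral>y. ?k2 x y \<partial>P \<partial>Pc i)
          = (\<integral>x. (\<Sum>j=1..k. w j * (\<integral>y. ?k2 x y \<partial>Pc j)) \<partial>Pc i)" by simp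
      also have "\<dots> = (\<Sum>j=1..k. \<integral>x. w j * (\<integral>y. ?k2 x y \<partial>Pc j) \<partial>Pc i)"
        by (intro Bochner_Integration.integral_sum integrable_mult_right
            integrable_iterated_integral(2)[OF Pi1[OF i] Pi2[OF i] Pi1 Pi2 k2m
              gauss_kernel_power2_bounds])
      finally show "w i * (\<integral>x. \<integral>y. ?k2 x y \<partial>P \<partial>Pc i) = w i * (\<Sum>j=1..k. w j * J i j)"
        by (simp add: J_def)
    qed
    also have "\<dots> = (\<Sum>i=1..k. \<Sum>j=1..k. w i * w j * J i j)"
      by (simp add: sum_distrib_left mult.assoc)
    finally show ?thesis
      using sum_power2_eigenvalue_le_integral[OF P_prob P_sets cov, of k] by (simp add: lam_def)
  qed
  have "\<forall>i\<in>{1..k}. \<exists>m. \<forall>h. inner m h = (\<integral>x. inner (phi x) h \<partial>Pc i)"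
    using mean_embedding_exists Pi by blast
  then obtain m where m: "\<And>i. i \<in> {1..k} \<Longrightarrow> \<forall>h. inner (m i) h = (\<integral>x. inner (phi x) h \<partial>Pc i)"
    by metis
  \<comment> \<open>Summation by parts with \<open>q i = w i * I i\<close>; this is where the
    sorting of the weights enters.\<close>
  have trace_le: "(\<Sum>i=1..k. w i * (w i * I i)) \<le> (\<Sum>i=1..k. w i * lam i)"
  proof (rule abel_sum_mono)
    fix r assume r: "r \<le> k"
    have "(\<Sum>i=1..r. w i * (norm (m i))\<^sup>2) \<le> (\<Sum>i=1..r. lam i)"
      unfolding lam_def
    proof (rule sum_norm_le_sum_op_eigenvalue)
      fix h
      \<comment> \<open>Dropping the components beyond \<open>r\<close> only lowers the form; Jensen
        within each component then leads to the form of \<open>C\<close>.\<close>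
      have "(\<Sum>i=1..r. w i * (inner (m i) h)\<^sup>2) \<le> (\<Sum>i=1..k. w i * (inner (m i) h)\<^sup>2)"
        using r w0 by (intro sum_mono2) auto
      also have "\<dots> \<le> (\<Sum>i=1..k. w i * (\<integral>x. (inner (phi x) h)\<^sup>2 \<partial>Pc i))"
      proof (intro sum_mono mult_left_mono w0)
        fix i assume i: "i \<in> {1..k}"
        show "(inner (m i) h)\<^sup>2 \<le> (\<integral>x. (inner (phi x) h)\<^sup>2 \<partial>Pc i)"
          using power2_integral_le[OF Pi1[OF i] Pi2[OF i] feature_inner_measurable feature_inner_bound]
            m[OF i] by simp
      qed
      also have "\<dots> = (\<integral>x. (inner (phi x) h)\<^sup>2 \<partial>P)"
        by (rule mixture[where K = "(norm h)\<^sup>2", symmetric]) (simp_all add: feature_inner_power2_bound)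
      also have "\<dots> = inner (C h) h"
        using cov by (simp add: is_kernel_cov_op_def power2_eq_square)
      finally show "(\<Sum>i=1..r. w i * (inner (m i) h)\<^sup>2) \<le> inner (C h) h" .
    qed
    moreover have "(norm (m i))\<^sup>2 = I i" if "i \<in> {1..r}" for i
      unfolding I_def by (rule norm_mean_embedding[OF m]) (use that r in simp)
    ultimately show "(\<Sum>i=1..r. w i * I i) \<le> (\<Sum>i=1..r. lam i)" by simp
  qed (use w0 w_sorted in auto)
  \<comment> \<open>The diagonal correction completes \<open>J i i\<close> to the mean of
    \<open>(1 - k)\<^sup>2\<close>, with \<open>k\<close> the kernel; off the diagonal the squared
    kernel itself has to be small.\<close>
  have entry: "w i * w j * J i j - (if i = j then 2 * (w i * (w i * I i)) - (w i)\<^sup>2 else 0)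
      \<le> 2 * w i * w j * v i + 2 * w i * w j * v j + (if i = j then 0 else 2 * w i * w j * e i j)"
    if ij: "i \<in> {1..k}" "j \<in> {1..k}" for i j
  proof (cases "i = j")
    case True
    have "J i i - 2 * I i + 1 \<le> 2 * v i"
      unfolding J_def I_def v_def
      by (rule gauss_kernel_diagonal_defect[OF s_pos Pi1[OF ij(1)] Pi2[OF ij(1)] Pv[OF ij(1)]])
    \<comment> \<open>Weakened from 2 to 4 to match the off-diagonal shape
      \<open>2 * v i + 2 * v j\<close> at \<open>i = j\<close>.\<close>
    then have "J i i - 2 * I i + 1 \<le> 4 * v i" using v0[of i] by simp
    from mult_left_mono[OF this zero_le_power2[of "w i"]] show ?thesis
      using True by (simp add: power2_eq_square algebra_simps)
  next
    case False
    have "J i j \<le> 2 * e i j + (2 / s\<^sup>2) * ((sig i)\<^sup>2 + (sig j)\<^sup>2)"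
      unfolding J_def e_def
      by (rule iterated_integral_le[OF Pi1[OF ij(1)] Pi2[OF ij(1)] Pi1[OF ij(2)] Pi2[OF ij(2)] k2m
            gauss_kernel_power2_bounds Pv[OF ij(1)] Pv[OF ij(2)] gauss_kernel_power2_le[OF s_pos]])
        simp
    also have "\<dots> = 2 * e i j + 2 * v i + 2 * v j" by (simp add: v_def algebra_simps add_divide_distrib)
    finally have "J i j \<le> 2 * e i j + 2 * v i + 2 * v j" .
    from mult_left_mono[OF this, of "w i * w j"] show ?thesis
      using False w0[OF ij(1)] w0[OF ij(2)] by (simp add: algebra_simps)
  qed
  have ws: "(\<Sum>j=1..k. c * w j) = c" for c
    using w_sum by (simp flip: sum_distrib_left)
  have esym: "2 * w i * w j * e i j = 2 * w j * w i * e j i" for i j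
    by (simp add: e_def norm_minus_commute)
  have "(\<Sum>i=1..k. (lam i - w i)\<^sup>2)
      = (\<Sum>i=1..k. (lam i)\<^sup>2) - 2 * (\<Sum>i=1..k. w i * lam i) + (\<Sum>i=1..k. (w i)\<^sup>2)"
    by (simp add: power2_diff sum.distrib sum_subtractf sum_distrib_left mult_ac)
  also have "\<dots> \<le> (\<Sum>i=1..k. \<Sum>j=1..k. w i * w j * J i j)
      - 2 * (\<Sum>i=1..k. w i * (w i * I i)) + (\<Sum>i=1..k. (w i)\<^sup>2)"
    using hs trace_le by simp
  \<comment> \<open>The two single sums become diagonal entries of the double sum.\<close>
  also have "\<dots> = (\<Sum>i=1..k. \<Sum>j=1..k. w i * w j * J i j
      - (if i = j then 2 * (w i * (w i * I i)) - (w i)\<^sup>2 else 0))"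
    by (simp add: sum_subtractf sum.delta' sum_distrib_left)
  also have "\<dots> \<le> (\<Sum>i=1..k. \<Sum>j=1..k. 2 * w i * w j * v i + 2 * w i * w j * v j
      + (if i = j then 0 else 2 * w i * w j * e i j))"
    by (intro sum_mono entry)
  also have "\<dots> = (\<Sum>i=1..k. \<Sum>j=1..k. 2 * w i * w j * v i) + (\<Sum>i=1..k. \<Sum>j=1..k. 2 * w i * w j * v j)
      + (\<Sum>i=1..k. \<Sum>j=1..k. if i = j then 0 else 2 * w i * w j * e i j)"
    by (simp only: sum.distrib)
  finally have total: "(\<Sum>i=1..k. (lam i - w i)\<^sup>2) \<le> \<dots>" .
  \<comment> \<open>The weights sum to 1, which removes the free index; the two variance sums
    together give the constant 4.\<close>
  have v1: "(\<Sum>i=1..k. \<Sum>j=1..k. 2 * w i * w j * v i) = 2 * (\<Sum>i=1..k. w i * v i)"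
    using ws[of "2 * w _ * v _"] by (simp add: sum_distrib_left mult_ac)
  have "(\<Sum>i=1..k. \<Sum>j=1..k. 2 * w i * w j * v j) = (\<Sum>j=1..k. \<Sum>i=1..k. 2 * w j * w i * v j)"
    by (subst sum.swap) (simp add: mult_ac)
  also note v1
  finally have v2: "(\<Sum>i=1..k. \<Sum>j=1..k. 2 * w i * w j * v j) = 2 * (\<Sum>i=1..k. w i * v i)" .
  have "(\<Sum>i=1..k. \<Sum>j=1..k. if i = j then 0 else 2 * w i * w j * e i j)
      = 2 * (\<Sum>i=2..k. \<Sum>j=1..i-1. 2 * w i * w j * e i j)"
    by (rule sum_off_diagonal_symmetric[OF esym])
  \<comment> \<open>\<open>w j \<le> 1\<close> leaves the weight of the larger index. A factor 2
    would do in place of 8, which is taken to reach the constant 16.\<close>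
  also have "\<dots> \<le> 2 * (\<Sum>i=2..k. \<Sum>j=1..i-1. 8 * (w i * e i j))"
  proof (intro mult_left_mono sum_mono)
    fix i j assume i: "i \<in> {2..k}" and j: "j \<in> {1..i-1}"
    then have "w j \<le> 1" by (intro w1) auto
    then have "w i * e i j * (2 * w j) \<le> w i * e i j * 8"
      using w0[of i] i by (intro mult_left_mono) (auto simp: e_def)
    then show "2 * w i * w j * e i j \<le> 8 * (w i * e i j)" by (simp add: mult_ac)
  qed simp
  also have "\<dots> = 16 * (\<Sum>i=2..k. \<Sum>j=1..i-1. w i * e i j)"
    by (simp add: sum_distrib_left)
  finally have "(\<Sum>i=1..k. (lam i - w i)\<^sup>2)
      \<le> 4 * (\<Sum>i=1..k. w i * v i) + 16 * (\<Sum>i=2..k. \<Sum>j=1..i-1. w i * e i j)"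
    using total unfolding v1 v2 by linarith
  then show ?thesis by (simp add: lam_def v_def e_def)
qed

end
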